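(* Let $(\Omega,\mathcal B,\mathbb P,(\mathfrak P_N)_{N\in\mathfrak N})$ be an $\mathfrak N$-refined standard Borel probability space, let $\mathsf Z$ and $\mathsf Z'$ be separable Banach spaces and let $Z\in L^0(\Omega,\mathcal B,\mathbb P;\mathsf Z)$, $Z'\in L^0(\Omega,\mathcal B,\mathbb P;\mathsf Z')$. Then for every $\mu\in\Gamma(Z_\sharp\mathbb P,Z'_\sharp\mathbb P)$ there exist a totally ordered strictly increasing sequence $(N_n)_n\subset\mathfrak N$ and maps $g_n\in\mathrm S(\Omega,\mathcal B,\mathbb P;\mathcal B_{N_n})$ such that $$(Z,Z'\circ g_n)_\sharp\mathbb P\to\mu\quad\text{in }\mathcal P(\mathsf Z\times\mathsf Z').$$ In particular, if $\mathsf X$ and $\mathsf Y$ are separable Banach spaces, $p,q\in[1,+\infty)$, $X,X'\in L^p(\Omega,\mathcal B,\mathbb P;\mathsf X)$, $Y,Y'\in L^q(\Omega,\mathcal B,\mathbb P;\mathsf Y)$, and $(X,Y)_\sharp\mathbb P=(X',Y')_\sharp\mathbb P$, then there exist a totally ordered strictly increasing sequence $(N_n)_n\subset\mathfrak N$ and maps $g_n\in\mathrm S(\Omega,\mathcal B,\mathbb P;\mathcal B_{N_n})$ such that $X'\circ g_n\to X$ in $L^p(\Omega,\mathcal B,\mathbb P;\mathsf X)$ and $Y'\circ g_n\to Y$ in $L^q(\Omega,\mathcal B,\mathbb P;\mathsf Y)$ as $n\to\infty$.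
   Context: On the positive integers write $m\prec n$ iff $m\mid n$; "totally ordered" and "strictly increasing" refer to $\prec$. $\mathfrak N\subset\mathbb N$ is an unbounded set directed w.r.t. $\prec$. For $N\in\mathbb N$, $I_N:=\{0,\dots,N-1\}$. Let $(\Omega,\mathcal B)$ be a standard Borel space with a nonatomic positive finite measure $\mathfrak m$. An $N$-partition is a family $\{\Omega_{N,k}\}_{k\in I_N}\subset\mathcal B$ of pairwise disjoint sets with union $\Omega$. An $\mathfrak N$-segmentation of $(\Omega,\mathcal B,\mathfrak m)$ is a collection $(\mathfrak P_N)_{N\in\mathfrak N}$, with $\mathcal B_N:=\sigma(\mathfrak P_N)$, such that: (1) $\mathfrak P_N=\{\Omega_{N,k}\}_{k\in I_N}$ is an $N$-partition for every $N\in\mathfrak N$; (2) $\mathfrak m(\Omega_{N,k})=\mathfrak m(\Omega)/N$ for all $k\in I_N$, $N\in\mathfrak N$; (3) if $M,N\in\mathfrak N$ and $N=KM$, then $\bigcup_{k=0}^{K-1}\Omega_{N,mK+k}=\Omega_{M,m}$ for $m\in I_M$; (4) $\sigma(\{\mathcal B_N:N\in\mathfrak N\})=\mathcal B$. Then $(\Omega,\mathcal B,\mathfrak m,(\mathfrak P_N)_{N\in\mathfrak N})$ is called an $\mathfrak N$-refined standard Borel measure space (probability space if $\mathfrak m$ is a probability). $\mathrm S(\Omega,\mathcal B,\mathbb P)$ is the class of $\mathcal B$-$\mathcal B$-measurable maps $g:\Omega\to\Omega$ that are essentially injective (injective on a set of full measure in $\mathcal B$) and satisfy $g_\sharp\mathbb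 P=\mathbb P$; $\mathrm S(\Omega,\mathcal B,\mathbb P;\mathcal A)$ is the subset of those which are also $\mathcal A$-$\mathcal A$ measurable, for a sub-$\sigma$-algebra $\mathcal A\subset\mathcal B$. $\Gamma(\alpha,\beta)$ is the set of Borel probability measures on the product space with first marginal $\alpha$ and second marginal $\beta$. $L^0(\Omega,\mathcal B,\mathbb P;\mathsf Z)$ is the space of ($\mathbb P$-a.e. classes of) measurable maps to $\mathsf Z$. $\mathcal P(\mathsf Z\times\mathsf Z')$ is the set of Borel probability measures, with the narrow topology (convergence against bounded continuous functions). *)

theory Defs
  imports "HOL-Probability.Probability"
begin

section \<open>The divisibility order on the positive integers\<close>

text \<open>Positivity matters: \<open>0\<close> is the top element of \<open>dvd\<close> on \<^typ>\<open>nat\<close>, so with \<open>0\<close>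
  admitted every set containing \<open>0\<close> would be directed.\<close>

definition unbounded_directed :: "nat set \<Rightarrow> bool" where
  "unbounded_directed \<NN> \<longleftrightarrow>
     \<NN> \<subseteq> {0<..} \<and> \<not> bdd_above \<NN> \<and> (\<forall>m\<in>\<NN>. \<forall>n\<in>\<NN>. \<exists>l\<in>\<NN>. m dvd l \<and> n dvd l)"

text \<open>The range of such a sequence is totally ordered by \<open>dvd\<close>.\<close>

definition dvd_strictly_increasing :: "(nat \<Rightarrow> nat) \<Rightarrow> bool" where
  "dvd_strictly_increasing N \<longleftrightarrow> monotone (<) (\<lambda>m n. m dvd n \<and> m \<noteq> n) N"


section \<open>Refined standard Borel measure spaces\<close>

definition standard_borel :: "'a measure \<Rightarrow> bool" where
  "standard_borel M \<longleftrightarrow>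
     (\<exists>T. completely_metrizable_space T \<and> second_countable T \<and> topspace T = space M \<and>
          sets M = sigma_sets (space M) {U. openin T U})"

definition nonatomic :: "'a measure \<Rightarrow> bool" where
  "nonatomic M \<longleftrightarrow>
     \<not> (\<exists>A\<in>sets M. emeasure M A > 0 \<and>
          (\<forall>B\<in>sets M. B \<subseteq> A \<longrightarrow> emeasure M B = 0 \<or> emeasure M B = emeasure M A))"

definition is_partition :: "'a measure \<Rightarrow> nat \<Rightarrow> (nat \<Rightarrow> 'a set) \<Rightarrow> bool" where
  "is_partition M N A \<longleftrightarrow>
     A ` {..<N} \<subseteq> sets M \<and> disjoint_family_on A {..<N} \<and> (\<Union>k<N. A k) = space M"

text \<open>The sub-\<open>\<sigma>\<close>-algebra generated by the \<open>N\<close>-th partition. The measure carried by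
  \<^const>\<open>sigma\<close> is irrelevant; only its space and its measurable sets are used.\<close>

definition partition_algebra :: "'a measure \<Rightarrow> (nat \<Rightarrow> nat \<Rightarrow> 'a set) \<Rightarrow> nat \<Rightarrow> 'a measure" where
  "partition_algebra M P N = sigma (space M) (P N ` {..<N})"

definition segmentation :: "nat set \<Rightarrow> 'a measure \<Rightarrow> (nat \<Rightarrow> nat \<Rightarrow> 'a set) \<Rightarrow> bool" where
  "segmentation \<NN> M P \<longleftrightarrow>
     (\<forall>N\<in>\<NN>. is_partition M N (P N)) \<and>
     (\<forall>N\<in>\<NN>. \<forall>k<N. measure M (P N k) = measure M (space M) / real N) \<and>
     (\<forall>L\<in>\<NN>. \<forall>N\<in>\<NN>. \<forall>K. N = K * L \<longrightarrow> (\<forall>m<L. (\<Union>k<K. P N (m * K + k)) = P L m)) \<and>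
     sigma_sets (space M) (\<Union>N\<in>\<NN>. sets (partition_algebra M P N)) = sets M"

definition refined_standard_borel_space ::
    "nat set \<Rightarrow> 'a measure \<Rightarrow> (nat \<Rightarrow> nat \<Rightarrow> 'a set) \<Rightarrow> bool" where
  "refined_standard_borel_space \<NN> M P \<longleftrightarrow>
     unbounded_directed \<NN> \<and> standard_borel M \<and> finite_measure M \<and> nonatomic M \<and>
     segmentation \<NN> M P"

definition refined_standard_borel_prob_space ::
    "nat set \<Rightarrow> 'a measure \<Rightarrow> (nat \<Rightarrow> nat \<Rightarrow> 'a set) \<Rightarrow> bool" where
  "refined_standard_borel_prob_space \<NN> M P \<longleftrightarrow>
     refined_standard_borel_space \<NN> M P \<and> prob_space M"


section \<open>Measure-preserving essentially injective maps\<close>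

definition ess_injective :: "'a measure \<Rightarrow> ('a \<Rightarrow> 'a) \<Rightarrow> bool" where
  "ess_injective M g \<longleftrightarrow> (\<exists>A\<in>sets M. emeasure M (space M - A) = 0 \<and> inj_on g A)"

definition mp_maps :: "'a measure \<Rightarrow> ('a \<Rightarrow> 'a) set" where
  "mp_maps M = {g \<in> M \<rightarrow>\<^sub>M M. ess_injective M g \<and> distr M M g = M}"

definition mp_maps_sub :: "'a measure \<Rightarrow> 'a measure \<Rightarrow> ('a \<Rightarrow> 'a) set" where
  "mp_maps_sub M A = {g \<in> mp_maps M. g \<in> A \<rightarrow>\<^sub>M A}"


section \<open>Couplings, narrow convergence, Lebesgue-Bochner spaces\<close>

definition borel_prob_measures :: "'a::topological_space measure set" where
  "borel_prob_measures = {\<mu>. prob_space \<mu> \<and> sets \<mu> = sets borel}"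

definition couplings ::
    "'a::topological_space measure \<Rightarrow> 'b::topological_space measure \<Rightarrow> ('a \<times> 'b) measure set" where
  "couplings \<alpha> \<beta> =
     {\<mu> \<in> borel_prob_measures. distr \<mu> borel fst = \<alpha> \<and> distr \<mu> borel snd = \<beta>}"

definition narrowly_converges ::
    "(nat \<Rightarrow> 'a::topological_space measure) \<Rightarrow> 'a measure \<Rightarrow> bool" where
  "narrowly_converges \<mu>s \<mu> \<longleftrightarrow>
     (\<forall>n. \<mu>s n \<in> borel_prob_measures) \<and> \<mu> \<in> borel_prob_measures \<and>
     (\<forall>f::'a \<Rightarrow> real. continuous_on UNIV f \<and> bounded (range f) \<longrightarrow>
        (\<lambda>n. \<integral>x. f x \<partial>\<mu>s n) \<longlonglongrightarrow> (\<integral>x. f x \<partial>\<mu>))"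

text \<open>Elements of \<open>L\<^sup>p\<close> are represented by Borel functions; in a separable Banach space Borel
  and strong measurability coincide.\<close>

definition Lp_functions ::
    "'a measure \<Rightarrow> real \<Rightarrow> ('a \<Rightarrow> 'b::{banach, second_countable_topology}) set" where
  "Lp_functions M p = {f \<in> borel_measurable M. integrable M (\<lambda>x. norm (f x) powr p)}"

definition Lp_norm ::
    "'a measure \<Rightarrow> real \<Rightarrow> ('a \<Rightarrow> 'b::{banach, second_countable_topology}) \<Rightarrow> real" where
  "Lp_norm M p f = (\<integral>x. norm (f x) powr p \<partial>M) powr (1 / p)"

text \<open>Membership in \<open>L\<^sup>p\<close> is required explicitly because the Bochner integral of a
  non-integrable function is \<open>0\<close>.\<close>

definition Lp_converges ::
    "'a measure \<Rightarrow> real \<Rightarrow> (nat \<Rightarrow> 'a \<Rightarrow> 'b::{banach, second_countable_topology}) \<Rightarrow>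
      ('a \<Rightarrow> 'b) \<Rightarrow> bool" where
  "Lp_converges M p F f \<longleftrightarrow>
     (\<forall>n. F n \<in> Lp_functions M p) \<and> f \<in> Lp_functions M p \<and>
     (\<lambda>n. Lp_norm M p (\<lambda>x. F n x - f x)) \<longlonglongrightarrow> 0"

end

theory Submission
  imports Defs "HOL-Combinatorics.Permutations"
begin

text \<open>
  Why the theorem holds. By directedness the segmentation can be replaced by a single chain
  \<open>N 0 dvd N 1 dvd \<dots>\<close> in \<open>\<NN>\<close> that is cofinal for divisibility; its cells still generate the
  \<open>\<sigma>\<close>-algebra. The proof then has two halves.

  The first half is measure theoretic: every permutation \<open>\<sigma>\<close> of the cells of a level of the chain is
  induced by an essentially injective, measure-preserving map (\<open>cell_permuting_map\<close>). The nested cells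
  act as the digits of a point \<open>\<Phi> \<omega>\<close> of the unit interval. The law of \<open>\<Phi>\<close> is uniform, and \<open>\<Phi>\<close> is
  injective outside the preimage of the countably many endpoints. On the interval \<open>\<sigma>\<close> acts by
  interchanging intervals of equal length, which preserves Lebesgue measure; the map sought is this
  interval exchange, conjugated by \<open>\<Phi>\<close>. For that the range of \<open>\<Phi>\<close> must contain a Borel set of full
  measure, and here the completeness of the underlying topology enters
  (\<open>standard_borel_image_full\<close>): the graph of \<open>\<Phi>\<close> is a Borel subset of a Polish space, so it is
  exhausted up to null sets by compact sets, whose projections are compact.

  The second half is combinatorial. If \<open>Z\<close> and \<open>Z'\<close> are replaced by labels with finitely many values,
  then on a fine level they are constant on cells up to a small error, and a coupling becomes a matrix
  of masses with prescribed row and column sums. Rounding it to integer counts of cells, one finds a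
  permutation of the cells that realises these counts, hence a map \<open>g\<close> for which the labels of \<open>Z\<close> and
  \<open>Z' \<circ> g\<close> have almost the prescribed joint law (\<open>coupling_label_approx\<close>). Taking as labels the
  traces of the first \<open>n\<close> sets of a countable base, the joint laws of the labels determine the narrow
  limit (\<open>narrowly_converges_if_labels_converge\<close>): a bounded continuous function is the pointwise limit
  of its infima over the label classes.

  For the statement on \<open>L\<^sup>p\<close>, apply the first part to \<open>Z = (X, Y)\<close>, \<open>Z' = (X', Y')\<close> and the diagonal
  coupling. Since \<open>X' \<circ> g\<close> has the same law as \<open>X\<close>, narrow convergence to the diagonal improves to
  convergence in norm by a Fatou argument (\<open>Lp_converges_of_narrow\<close>).
\<close>

section \<open>Standard Borel spaces and images of full measure\<close>

text \<open>The embedding sends a point to its distances from a dense sequence. Completeness makes the image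
  describable by countably many conditions on these distances, which is why it is Borel; the inverse is
  measurable because the balls around the dense sequence generate.\<close>

lemma standard_borel_embedding:
  fixes M :: "'a measure"
  assumes "standard_borel M"
  obtains \<iota> :: "'a \<Rightarrow> nat \<Rightarrow> real" where
    "\<iota> \<in> borel_measurable M" "inj_on \<iota> (space M)" "\<iota> ` space M \<in> sets borel"
    "inv_into (space M) \<iota> \<in> restrict_space borel (\<iota> ` space M) \<rightarrow>\<^sub>M M"
proof (cases "space M = {}")
  case True
  show thesis
    by (rule that[of "\<lambda>_ _. 0"]) (use True in \<open>auto simp: measurable_def space_restrict_space\<close>)
next
  case False
  obtain T where T: "completely_metrizable_space T" "second_countable T" "topspace T = space M"
    and sets_T: "sets M = sigma_sets (space M) {U. openin T U}"
    using assms unfolding standard_borel_def by blast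
  obtain M' d where "Metric_space M' d" and compl: "Metric_space.mcomplete M' d"
    and T_eq: "T = Metric_space.mtopology M' d"
    using T(1) unfolding completely_metrizable_space_def by blast
  interpret Metric_space M' d by fact
  have M'_eq: "space M = M'" using T(3) T_eq by simp
  obtain C where C: "countable C" "C \<subseteq> space M" "T closure_of C = space M"
    using second_countable_imp_separable_space[OF T(2)] T(3) unfolding separable_space_def by metis
  have dense: "C \<inter> U \<noteq> {}" if "openin T U" "U \<noteq> {}" for U
    using C(3) T(3) dense_intersects_open[of T C] that by metis
  have "C \<noteq> {}"
    using dense[OF openin_topspace] False T(3) by auto
  define x where "x = from_nat_into C"
  have x_in: "x i \<in> M'" for i
    using from_nat_into[OF \<open>C \<noteq> {}\<close>] C(2) M'_eq by (auto simp: x_def)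
  have x_dense: "\<exists>i. d \<omega> (x i) < r" if "\<omega> \<in> M'" "r > 0" for \<omega> r
  proof -
    have "C \<inter> mball \<omega> r \<noteq> {}"
      using that by (intro dense) (auto simp: T_eq)
    then obtain c where "c \<in> C" "d \<omega> c < r" by auto
    moreover obtain i where "x i = c"
      using \<open>c \<in> C\<close> C(1) unfolding x_def by (metis from_nat_into_surj)
    ultimately show ?thesis by auto
  qed
  define \<iota> where "\<iota> = (\<lambda>\<omega> i. d \<omega> (x i))"
  \<comment> \<open>For \<open>h \<in> G\<close> the points \<open>x i\<close> are Cauchy along indices with \<open>h i\<close> tending to zero, and the
      distances of their limit from the dense sequence are \<open>h\<close>.\<close>
  define G where "G = {h :: nat \<Rightarrow> real.
    (\<forall>i j. \<bar>h i - h j\<bar> \<le> d (x i) (x j) \<and> d (x i) (x j) \<le> h i + h j) \<and> (\<forall>m::nat. \<exists>i. h i < 1 / Suc m)}"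
  have [measurable]: "\<iota> \<in> borel_measurable M"
  proof (rule measurable_coordinatewise_then_product)
    fix i
    show "(\<lambda>\<omega>. \<iota> \<omega> i) \<in> borel_measurable M"
    proof (rule borel_measurableI_less)
      fix r
      have "{\<omega> \<in> space M. \<iota> \<omega> i < r} = mball (x i) r"
        using x_in by (auto simp: \<iota>_def M'_eq commute)
      then show "{\<omega> \<in> space M. \<iota> \<omega> i < r} \<in> sets M"
        using sets_T T_eq by (auto intro: sigma_sets.Basic)
    qed
  qed
  have inj: "inj_on \<iota> (space M)"
  proof (rule inj_onI, rule ccontr)
    fix \<omega> \<omega>' assume *: "\<omega> \<in> space M" "\<omega>' \<in> space M" "\<iota> \<omega> = \<iota> \<omega>'" "\<omega> \<noteq> \<omega>'"
    then have "d \<omega> \<omega>' / 2 > 0" using M'_eq by simp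
    then obtain i where i: "d \<omega> (x i) < d \<omega> \<omega>' / 2" using x_dense * M'_eq by blast
    have "d \<omega>' (x i) = d \<omega> (x i)" using *(3) unfolding \<iota>_def by metis
    moreover have "d \<omega> \<omega>' \<le> d \<omega> (x i) + d \<omega>' (x i)"
      using triangle[of \<omega> "x i" \<omega>'] * x_in M'_eq commute by metis
    ultimately show False using i by linarith
  qed
  have "\<iota> ` space M \<subseteq> G"
  proof
    fix h assume "h \<in> \<iota> ` space M"
    then obtain \<omega> where \<omega>: "\<omega> \<in> M'" "h = \<iota> \<omega>" using M'_eq by auto
    have "\<bar>d \<omega> (x i) - d \<omega> (x j)\<bar> \<le> d (x i) (x j)" "d (x i) (x j) \<le> d \<omega> (x i) + d \<omega> (x j)" for i j
      using triangle[of \<omega> "x i" "x j"] triangle[of \<omega> "x j" "x i"] triangle[of "x i" \<omega> "x j"]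
        \<omega>(1) x_in commute[of "x i" "x j"] commute[of "x i" \<omega>] by auto
    then show "h \<in> G" using x_dense[OF \<omega>(1)] by (auto simp: G_def \<omega>(2) \<iota>_def)
  qed
  moreover have "G \<subseteq> \<iota> ` space M"
  proof
    fix h assume h: "h \<in> G"
    then obtain i where i: "\<And>m::nat. h (i m) < 1 / Suc m" unfolding G_def by auto metis
    have "MCauchy (\<lambda>m. x (i m))"
      unfolding MCauchy_def
    proof (intro conjI allI impI)
      fix \<epsilon> :: real assume "\<epsilon> > 0"
      then obtain K :: nat where K: "1 / Suc K < \<epsilon> / 2"
        using nat_approx_posE[of "\<epsilon>/2"] by auto
      have "d (x (i n)) (x (i n')) < \<epsilon>" if "K \<le> n" "K \<le> n'" for n n'
      proof -
        have "1 / real (Suc n) \<le> 1 / Suc K" "1 / real (Suc n') \<le> 1 / Suc K"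
          using that by (auto simp: frac_le)
        moreover have "d (x (i n)) (x (i n')) \<le> h (i n) + h (i n')" using h by (auto simp: G_def)
        ultimately show ?thesis using i[of n] i[of n'] K by linarith
      qed
      then show "\<exists>N. \<forall>n n'. N \<le> n \<longrightarrow> N \<le> n' \<longrightarrow> d (x (i n)) (x (i n')) < \<epsilon>" by blast
    qed (use x_in in auto)
    then obtain \<omega> where \<omega>: "limitin mtopology (\<lambda>m. x (i m)) \<omega> sequentially"
      using compl unfolding mcomplete_def by blast
    then have \<omega>_in: "\<omega> \<in> M'" using limitin_metric by blast
    have "d \<omega> (x j) = h j" for j
    proof (rule ccontr)
      assume "d \<omega> (x j) \<noteq> h j"
      define \<epsilon> where "\<epsilon> = \<bar>d \<omega> (x j) - h j\<bar> / 2"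
      have "\<epsilon> > 0" using \<open>d \<omega> (x j) \<noteq> h j\<close> by (simp add: \<epsilon>_def)
      then obtain K :: nat where K: "1 / Suc K < \<epsilon>"
        using nat_approx_posE by auto
      from \<omega> \<open>\<epsilon> > 0\<close> obtain K' where K': "\<And>m. m \<ge> K' \<Longrightarrow> d (x (i m)) \<omega> < \<epsilon>"
        unfolding limitin_metric eventually_sequentially by blast
      define m where "m = max K K'"
      have "1 / real (Suc m) \<le> 1 / Suc K" by (auto simp: frac_le m_def)
      then have hm: "h (i m) < \<epsilon>" using i[of m] K by linarith
      have "\<bar>h j - d (x (i m)) (x j)\<bar> \<le> h (i m)"
      proof -
        have "\<bar>h (i m) - h j\<bar> \<le> d (x (i m)) (x j)" "d (x (i m)) (x j) \<le> h (i m) + h j"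
          using h by (auto simp: G_def)
        then show ?thesis by linarith
      qed
      moreover have "\<bar>d \<omega> (x j) - d (x (i m)) (x j)\<bar> \<le> d (x (i m)) \<omega>"
        using triangle[of \<omega> "x (i m)" "x j"] triangle[of "x (i m)" \<omega> "x j"] x_in \<omega>_in
          commute[of \<omega> "x (i m)"] by auto
      moreover have "d (x (i m)) \<omega> < \<epsilon>" by (rule K') (simp add: m_def)
      moreover have "\<bar>d \<omega> (x j) - h j\<bar>
          \<le> \<bar>h j - d (x (i m)) (x j)\<bar> + \<bar>d \<omega> (x j) - d (x (i m)) (x j)\<bar>" by linarith
      ultimately have "2 * \<epsilon> < \<epsilon> + \<epsilon>" using hm unfolding \<epsilon>_def by argo
      then show False by simp
    qed
    then have "\<iota> \<omega> = h" by (auto simp: \<iota>_def)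
    then show "h \<in> \<iota> ` space M" using \<omega>_in M'_eq by auto
  qed
  ultimately have img: "\<iota> ` space M = G" by blast
  have [measurable]: "G \<in> sets borel"
    unfolding G_def by measurable
  have sets_balls: "sets M = sigma_sets (space M) {mball (x i) r | i r. True}"
  proof (rule antisym)
    have "U \<in> sigma_sets (space M) {mball (x i) r | i r. True}" if U: "openin T U" for U
    proof -
      have "U = (\<Union>(i, q) \<in> {(i, q). q \<in> \<rat> \<and> mball (x i) q \<subseteq> U}. mball (x i) q)" (is "_ = ?V")
      proof (intro antisym subsetI)
        fix \<omega> assume \<omega>: "\<omega> \<in> U"
        then obtain r where r: "r > 0" "mball \<omega> r \<subseteq> U"
          using U unfolding T_eq openin_mtopology by blast
        have \<omega>M: "\<omega> \<in> M'" using \<omega> U T_eq openin_subset topspace_mtopology by blast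
        obtain q where q: "q \<in> \<rat>" "0 < q" "q < r / 2" using Rats_dense_in_real[of 0 "r/2"] r by auto
        obtain i where i: "d \<omega> (x i) < q" using x_dense[OF \<omega>M q(2)] by blast
        have "mball (x i) q \<subseteq> mball \<omega> r"
        proof
          fix z assume "z \<in> mball (x i) q"
          then have "z \<in> M'" "d (x i) z < q" by auto
          then show "z \<in> mball \<omega> r"
            using triangle[OF \<omega>M x_in[of i], of z] i q \<omega>M by auto
        qed
        then have "mball (x i) q \<subseteq> U" using r by blast
        moreover have "\<omega> \<in> mball (x i) q" using i \<omega>M x_in commute by auto
        ultimately show "\<omega> \<in> ?V" using q by blast
      qed auto
      also have "?V \<in> sigma_sets (space M) {mball (x i) r | i r. True}"
      proof -
        have c: "countable {(i :: nat, q :: real). q \<in> \<rat> \<and> mball (x i) q \<subseteq> U}"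
          by (rule countable_subset[of _ "UNIV \<times> \<rat>"]) (auto intro: countable_rat)
        interpret sigma_algebra "space M" "sigma_sets (space M) {mball (x i) r | i r. True}"
          by (rule sigma_algebra_sigma_sets) (auto simp: M'_eq)
        show ?thesis
          using c by (intro countable_UN'') (auto intro: sigma_sets.Basic)
      qed
      finally show ?thesis .
    qed
    then show "sets M \<subseteq> sigma_sets (space M) {mball (x i) r | i r. True}"
      unfolding sets_T by (intro sigma_sets_mono) auto
    show "sigma_sets (space M) {mball (x i) r | i r. True} \<subseteq> sets M"
      unfolding sets_T by (intro sigma_sets_mono) (auto simp: T_eq)
  qed
  have "inv_into (space M) \<iota> \<in> restrict_space borel (\<iota> ` space M) \<rightarrow>\<^sub>M M"
  proof (rule measurable_sigma_sets[OF sets_balls])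
    show "{mball (x i) r | i r. True} \<subseteq> Pow (space M)" by (auto simp: M'_eq)
    show "inv_into (space M) \<iota> \<in> space (restrict_space borel (\<iota> ` space M)) \<rightarrow> space M"
      by (auto simp: space_restrict_space inv_into_into)
    fix B assume "B \<in> {mball (x i) r | i r. True}"
    then obtain i r where B: "B = mball (x i) r" by blast
    have "inv_into (space M) \<iota> -` B \<inter> space (restrict_space borel (\<iota> ` space M))
      = {h \<in> G. h i < r}"
    proof -
      have "inv_into (space M) \<iota> (\<iota> \<omega>) \<in> B \<longleftrightarrow> \<iota> \<omega> i < r" if "\<omega> \<in> space M" for \<omega>
        unfolding inv_into_f_f[OF inj that]
        using that x_in M'_eq by (auto simp: B \<iota>_def commute)
      then show ?thesis unfolding img[symmetric] by (auto simp: space_restrict_space)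
    qed
    also have "{h \<in> G. h i < r} \<in> sets (restrict_space borel (\<iota> ` space M))"
      unfolding img by (subst sets_restrict_space_iff) auto
    finally show "inv_into (space M) \<iota> -` B \<inter> space (restrict_space borel (\<iota> ` space M))
      \<in> sets (restrict_space borel (\<iota> ` space M))" .
  qed
  with inj img show thesis
    by (intro that[of \<iota>]) auto
qed

text \<open>The image of \<open>\<Phi>\<close> is analytic and need not be Borel. Instead of the theory of analytic sets, the
  proof uses compact inner regularity on a Polish space: applied to the graph of \<open>\<Phi>\<close> it yields compact
  sets whose projections are compact subsets of the image, and these exhaust the measure.\<close>

lemma standard_borel_image_full:
  fixes M :: "'a measure" and \<Phi> :: "'a \<Rightarrow> 'b :: polish_space"
  assumes "standard_borel M" "finite_measure M" and [measurable]: "\<Phi> \<in> borel_measurable M"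
  obtains E where "E \<in> sets borel" "E \<subseteq> \<Phi> ` space M"
    "emeasure M (space M - \<Phi> -` E) = 0"
proof -
  interpret finite_measure M by fact
  obtain \<iota> :: "'a \<Rightarrow> nat \<Rightarrow> real" where [measurable]: "\<iota> \<in> borel_measurable M"
    and inj: "inj_on \<iota> (space M)" and [measurable]: "\<iota> ` space M \<in> sets borel"
    and inv[measurable]: "inv_into (space M) \<iota> \<in> restrict_space borel (\<iota> ` space M) \<rightarrow>\<^sub>M M"
    using standard_borel_embedding[OF assms(1)] by blast
  define j where "j = (\<lambda>\<omega>. (\<iota> \<omega>, \<Phi> \<omega>))"
  have j_meas[measurable]: "j \<in> borel_measurable M" unfolding j_def by measurable
  \<comment> \<open>In the coordinates \<open>\<iota>\<close> the graph is given by an equation between Borel functions.\<close>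
  have graph: "j ` space M \<in> sets borel"
  proof -
    define \<phi> where
      "\<phi> = (\<lambda>h. if h \<in> \<iota> ` space M then \<Phi> (inv_into (space M) \<iota> h) else undefined)"
    have "(\<lambda>h. \<Phi> (inv_into (space M) \<iota> h)) \<in> borel_measurable (restrict_space borel (\<iota> ` space M))"
      by measurable
    then have [measurable]: "\<phi> \<in> borel_measurable borel"
      unfolding \<phi>_def by (subst (asm) measurable_restrict_space_iff) auto
    have "j ` space M = {z. fst z \<in> \<iota> ` space M \<and> \<phi> (fst z) = snd z}"
    proof (intro antisym subsetI)
      fix z assume "z \<in> {z. fst z \<in> \<iota> ` space M \<and> \<phi> (fst z) = snd z}"
      then obtain \<omega> where "\<omega> \<in> space M" "fst z = \<iota> \<omega>" "\<phi> (fst z) = snd z" by auto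
      then show "z \<in> j ` space M"
        using inj by (intro image_eqI[of _ _ \<omega>]) (auto simp: j_def \<phi>_def prod_eq_iff)
    qed (use inj in \<open>auto simp: j_def \<phi>_def dest: inj_onD\<close>)
    also have "\<dots> = {z \<in> space (borel \<Otimes>\<^sub>M borel). fst z \<in> \<iota> ` space M \<and> \<phi> (fst z) = snd z}"
      by (simp add: space_pair_measure)
    also have "\<dots> \<in> sets (borel \<Otimes>\<^sub>M borel)" by measurable
    finally show ?thesis unfolding borel_prod .
  qed
  define \<nu> where "\<nu> = distr M borel j"
  have \<nu>_img: "emeasure \<nu> (j ` space M) = emeasure M (space M)"
    unfolding \<nu>_def using graph by (subst emeasure_distr) (auto intro!: arg_cong2[where f=emeasure])
  have "\<exists>K. compact K \<and> K \<subseteq> j ` space M \<and> emeasure M (space M) < emeasure \<nu> K + ennreal (1 / Suc n)" for n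
  proof -
    have "emeasure \<nu> (j ` space M) = (SUP K \<in> {K. K \<subseteq> j ` space M \<and> compact K}. emeasure \<nu> K)"
      using graph by (intro inner_regular) (auto simp: \<nu>_def emeasure_distr)
    then have "\<exists>K\<in>{K. K \<subseteq> j ` space M \<and> compact K}. emeasure M (space M) < emeasure \<nu> K + ennreal (1 / Suc n)"
      unfolding \<nu>_img
      by (rule SUP_approx_ennreal[rotated 2]) auto
    then show ?thesis by blast
  qed
  then obtain K where K: "\<And>n. compact (K n)" "\<And>n. K n \<subseteq> j ` space M"
    "\<And>n. emeasure M (space M) < emeasure \<nu> (K n) + ennreal (1 / Suc n)" by metis
  define E where "E = (\<Union>n. snd ` K n)"
  have snd_K: "compact (snd ` K n)" for n
    by (intro compact_continuous_image K continuous_intros)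
  have [measurable]: "E \<in> sets borel"
    unfolding E_def using snd_K by (intro sets.countable_UN) (auto intro: borel_compact)
  show thesis
  proof
    show "E \<in> sets borel" by fact
    show "E \<subseteq> \<Phi> ` space M" using K(2) by (fastforce simp: E_def j_def)
    have "measure M (space M - \<Phi> -` E) \<le> 1 / Suc n" for n
    proof -
      have *: "j -` K n \<inter> space M \<in> sets M"
        by (intro measurable_sets[OF j_meas] borel_compact K)
      have "space M - \<Phi> -` E \<subseteq> space M - (j -` K n \<inter> space M)"
        by (force simp: E_def j_def)
      then have "measure M (space M - \<Phi> -` E) \<le> measure M (space M - (j -` K n \<inter> space M))"
        using * by (intro finite_measure_mono) auto
      also have "\<dots> = measure M (space M) - measure M (j -` K n \<inter> space M)"
        using * by (rule finite_measure_compl)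
      also have "\<dots> \<le> 1 / Suc n"
      proof -
        have "emeasure \<nu> (K n) = ennreal (measure M (j -` K n \<inter> space M))"
          unfolding \<nu>_def using K(1) by (subst emeasure_distr) (auto intro: borel_compact simp: emeasure_eq_measure)
        then have "ennreal (measure M (space M)) < ennreal (measure M (j -` K n \<inter> space M) + 1 / Suc n)"
          using K(3)[of n] by (simp add: emeasure_eq_measure ennreal_plus[symmetric] del: ennreal_plus)
        then have "measure M (space M) < measure M (j -` K n \<inter> space M) + 1 / Suc n"
          by (simp add: ennreal_less_iff del: ennreal_plus)
        then show ?thesis by linarith
      qed
      finally show ?thesis .
    qed
    then have "measure M (space M - \<Phi> -` E) \<le> 0"
      using LIMSEQ_le_const[OF LIMSEQ_inverse_real_of_nat, of "measure M (space M - \<Phi> -` E)"]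
      by (auto simp: inverse_eq_divide)
    then show "emeasure M (space M - \<Phi> -` E) = 0"
      by (simp add: emeasure_eq_measure measure_le_0_iff)
  qed
qed

lemma singleton_in_standard_borel:
  assumes "standard_borel M" "\<omega> \<in> space M"
  shows "{\<omega>} \<in> sets M"
proof -
  obtain \<iota> :: "'a \<Rightarrow> nat \<Rightarrow> real" where \<iota>: "\<iota> \<in> borel_measurable M" "inj_on \<iota> (space M)"
    using standard_borel_embedding[OF assms(1)] by blast
  have "\<iota> -` {\<iota> \<omega>} \<inter> space M \<in> sets M"
    by (rule measurable_sets[OF \<iota>(1)]) auto
  also have "\<iota> -` {\<iota> \<omega>} \<inter> space M = {\<omega>}"
    using \<iota>(2) assms(2) by (auto dest: inj_onD)
  finally show ?thesis .
qed

section \<open>Interval exchanges preserve the uniform law\<close>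

definition uniform01 :: "real measure" where
  "uniform01 = uniform_measure lborel {0..<1}"

lemma emeasure_uniform01: "A \<in> sets borel \<Longrightarrow> emeasure uniform01 A = emeasure lborel ({0..<1} \<inter> A)"
  by (simp add: uniform01_def divide_ennreal_def)

lemma sets_uniform01 [simp, measurable_cong]: "sets uniform01 = sets borel"
  by (simp add: uniform01_def)

lemma prob_space_uniform01: "prob_space uniform01"
  unfolding uniform01_def by (rule prob_space_uniform_measure) auto

lemma cdf_uniform01: "cdf uniform01 x = min 1 (max 0 x)"
proof -
  have "{0..<1} \<inter> {..x} = (if x < 0 then {} else if x < 1 then {0..x} else {0..<1::real})"
    by auto
  then show ?thesis
    by (simp add: cdf_def measure_def emeasure_uniform01)
qed

text \<open>On the unit interval this translates the \<open>k\<close>-th of \<open>N\<close> equal intervals onto the \<open>\<sigma> k\<close>-th one; the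
  floor recovers the index \<open>k\<close> of the interval containing \<open>t\<close>.\<close>

definition interval_exchange :: "nat \<Rightarrow> (nat \<Rightarrow> nat) \<Rightarrow> real \<Rightarrow> real" where
  "interval_exchange N \<sigma> t =
     t + (real (\<sigma> (nat \<lfloor>N * t\<rfloor>)) - real (nat \<lfloor>N * t\<rfloor>)) / N"

lemma interval_exchange_measurable [measurable]: "interval_exchange N \<sigma> \<in> borel_measurable borel"
  unfolding interval_exchange_def by measurable

text \<open>Both measures are compared on the pieces \<open>I k\<close>: there the exchange is a translation onto \<open>I (\<sigma> k)\<close>,
  Lebesgue measure is translation invariant, and \<open>\<sigma>\<close> only reorders the sum over the pieces.\<close>

lemma distr_interval_exchange:
  assumes "N > 0" "\<sigma> permutes {..<N}"
  shows "distr uniform01 borel (interval_exchange N \<sigma>) = uniform01"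
proof (rule measure_eqI)
  fix A assume "A \<in> sets (distr uniform01 borel (interval_exchange N \<sigma>))"
  then have A[measurable]: "A \<in> sets borel" by simp
  define I where "I = (\<lambda>k. {real k / N ..< (real k + 1) / N})"
  define s where "s = (\<lambda>k. (real (\<sigma> k) - real k) / N)"
  have I_iff: "t \<in> I k \<longleftrightarrow> 0 \<le> t \<and> nat \<lfloor>N * t\<rfloor> = k" for t :: real and k
  proof -
    have "t \<in> I k \<longleftrightarrow> real k \<le> N * t \<and> N * t < real k + 1"
      using \<open>N > 0\<close> by (auto simp: I_def field_simps)
    also have "\<dots> \<longleftrightarrow> \<lfloor>N * t\<rfloor> = int k" by (auto simp: floor_eq_iff)
    also have "\<dots> \<longleftrightarrow> 0 \<le> t \<and> nat \<lfloor>N * t\<rfloor> = k"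
    proof (cases "0 \<le> t")
      case True
      then show ?thesis using \<open>N > 0\<close> by (auto simp: nat_eq_iff)
    next
      case False
      then have "N * t < 0" using \<open>N > 0\<close> by (simp add: mult_pos_neg)
      then have "\<lfloor>N * t\<rfloor> < 0" by simp
      then show ?thesis using False by linarith
    qed
    finally show ?thesis .
  qed
  have I_disj: "disjoint_family_on (\<lambda>k. I k \<inter> B k) {..<N}" for B
    by (auto simp: disjoint_family_on_def I_iff)
  have I_Un: "{0..<1} = (\<Union>k<N. I k)"
  proof -
    have "t < 1 \<longleftrightarrow> nat \<lfloor>N * t\<rfloor> < N" if "0 \<le> t" for t :: real
    proof -
      have "nat \<lfloor>N * t\<rfloor> < N \<longleftrightarrow> \<lfloor>N * t\<rfloor> < int N" using \<open>N > 0\<close> by (simp add: nat_less_iff that)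
      also have "\<dots> \<longleftrightarrow> N * t < N" by (simp add: floor_less_iff)
      finally show ?thesis using \<open>N > 0\<close> by simp
    qed
    then show ?thesis by (auto simp: I_iff)
  qed
  have shift: "emeasure lborel (I k \<inter> ((+) (s k) -` A)) = emeasure lborel (I (\<sigma> k) \<inter> A)" for k
  proof -
    have "t \<in> I k \<longleftrightarrow> s k + t \<in> I (\<sigma> k)" for t
      by (auto simp: I_def s_def add_divide_distrib diff_divide_distrib)
    then have "I k \<inter> ((+) (s k) -` A) = (+) (s k) -` (I (\<sigma> k) \<inter> A)" by auto
    moreover have "emeasure lborel ((+) (s k) -` (I (\<sigma> k) \<inter> A))
        = emeasure (distr lborel borel ((+) (s k))) (I (\<sigma> k) \<inter> A)"
      by (subst emeasure_distr) (auto simp: I_def)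
    ultimately show ?thesis by (simp add: lborel_distr_plus)
  qed
  have "emeasure (distr uniform01 borel (interval_exchange N \<sigma>)) A
      = emeasure uniform01 (interval_exchange N \<sigma> -` A)"
    by (subst emeasure_distr) (auto simp: uniform01_def)
  also have "\<dots> = emeasure lborel ({0..<1} \<inter> interval_exchange N \<sigma> -` A)"
    by (rule emeasure_uniform01) (rule measurable_sets_borel[OF interval_exchange_measurable A])
  also have "{0..<1} \<inter> interval_exchange N \<sigma> -` A = (\<Union>k<N. I k \<inter> ((+) (s k) -` A))"
    unfolding I_Un by (auto simp: I_iff interval_exchange_def s_def add.commute)
  also have "emeasure lborel \<dots> = (\<Sum>k<N. emeasure lborel (I k \<inter> ((+) (s k) -` A)))"
    using I_disj[of "\<lambda>k. (+) (s k) -` A"]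
    by (intro sum_emeasure[symmetric])
       (auto simp: I_def intro!: sets.Int measurable_sets_borel[OF _ A])
  also have "\<dots> = (\<Sum>k<N. emeasure lborel (I (\<sigma> k) \<inter> A))" by (simp add: shift)
  also have "\<dots> = (\<Sum>k<N. emeasure lborel (I k \<inter> A))"
    using sum.permute[OF assms(2), of "\<lambda>k. emeasure lborel (I k \<inter> A)"] by (simp add: o_def)
  also have "\<dots> = emeasure lborel (\<Union>k<N. I k \<inter> A)"
    using I_disj[of "\<lambda>_. A"] by (intro sum_emeasure) (auto simp: I_def)
  also have "\<dots> = emeasure uniform01 A"
    by (simp add: emeasure_uniform01 I_Un)
  finally show "emeasure (distr uniform01 borel (interval_exchange N \<sigma>)) A = emeasure uniform01 A" .
qed simp

section \<open>Refining partitions and maps that permute their cells\<close>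

text \<open>A chain of partitions is encoded by the functions \<open>c n\<close> that return the index of the cell of level
  \<open>n\<close> containing a point. Disjointness and covering then need no statement, the refinement condition
  becomes integer division of indices, and a map permutes the cells of level \<open>n\<close> by acting on
  the values of \<open>c n\<close>.\<close>

locale refining_partitions = prob_space M for M :: "'a measure" +
  fixes N :: "nat \<Rightarrow> nat" and c :: "nat \<Rightarrow> 'a \<Rightarrow> nat"
  assumes N_pos: "0 < N n"
    and N_dvd: "n \<le> m \<Longrightarrow> N n dvd N m"
    and N_ge: "n \<le> N n"
    and c_less: "\<omega> \<in> space M \<Longrightarrow> c n \<omega> < N n"
    and c_measurable [measurable]: "c n \<in> M \<rightarrow>\<^sub>M count_space UNIV"
    and prob_cell: "k < N n \<Longrightarrow> prob {\<omega> \<in> space M. c n \<omega> = k} = 1 / N n"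
    and c_refine: "n \<le> m \<Longrightarrow> \<omega> \<in> space M \<Longrightarrow> c n \<omega> = c m \<omega> div (N m div N n)"
    and generate: "sets M = sigma_sets (space M) {{\<omega> \<in> space M. c n \<omega> = k} | n k. True}"
    and standard: "standard_borel M"
begin

lemma prob_cells:
  assumes "J \<subseteq> {..<N n}"
  shows "prob {\<omega> \<in> space M. c n \<omega> \<in> J} = card J / N n"
proof -
  have fin: "finite J" using assms finite_subset by blast
  have "prob (\<Union>k\<in>J. {\<omega> \<in> space M. c n \<omega> = k}) = (\<Sum>k\<in>J. prob {\<omega> \<in> space M. c n \<omega> = k})"
    using fin by (intro finite_measure_finite_Union) (auto simp: disjoint_family_on_def)
  also have "\<dots> = (\<Sum>k\<in>J. 1 / N n)"
    using assms by (intro sum.cong refl prob_cell) auto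
  also have "(\<Union>k\<in>J. {\<omega> \<in> space M. c n \<omega> = k}) = {\<omega> \<in> space M. c n \<omega> \<in> J}" by auto
  finally show ?thesis by simp
qed

lemma cell_nested:
  assumes "n \<le> m" "\<omega> \<in> space M"
  shows "real (c n \<omega>) / N n \<le> real (c m \<omega>) / N m"
    and "(real (c m \<omega>) + 1) / N m \<le> (real (c n \<omega>) + 1) / N n"
proof -
  define K where "K = N m div N n"
  have K: "N m = K * N n" using N_dvd[OF assms(1)] by (simp add: K_def)
  then have "K > 0" using N_pos[of m] by (cases K) auto
  have "c n \<omega> = c m \<omega> div K" unfolding K_def using assms by (rule c_refine)
  then have "c n \<omega> * K \<le> c m \<omega>" "c m \<omega> + 1 \<le> (c n \<omega> + 1) * K"
    using \<open>K > 0\<close> div_times_less_eq_dividend by (auto simp: Suc_le_eq dividend_less_div_times)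
  then have "real (c n \<omega> * K) \<le> real (c m \<omega>)" "real (c m \<omega> + 1) \<le> real ((c n \<omega> + 1) * K)"
    using of_nat_le_iff by blast+
  then have "real (c n \<omega> * K) / N m \<le> real (c m \<omega>) / N m"
    "real (c m \<omega> + 1) / N m \<le> real ((c n \<omega> + 1) * K) / N m"
    by (auto intro!: divide_right_mono)
  moreover have "real (j * K) / N m = real j / N n" for j
    using \<open>K > 0\<close> by (simp add: K)
  ultimately show "real (c n \<omega>) / N n \<le> real (c m \<omega>) / N m"
    "(real (c m \<omega>) + 1) / N m \<le> (real (c n \<omega>) + 1) / N n"
    by (simp_all only: of_nat_add of_nat_1)
qed

text \<open>The left endpoints of the intervals attached to the cells of a point increase to this number; it is
  the expansion of the point with the cell indices as digits.\<close>

definition \<Phi> :: "'a \<Rightarrow> real" where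
  "\<Phi> \<omega> = (SUP n. real (c n \<omega>) / N n)"

lemma c_le_c:
  assumes "\<omega> \<in> space M"
  shows "real (c m \<omega>) / N m \<le> (real (c n \<omega>) + 1) / N n"
proof (cases "n \<le> m")
  case True
  have "real (c m \<omega>) / N m \<le> (real (c m \<omega>) + 1) / N m" by (simp add: divide_right_mono)
  then show ?thesis using cell_nested(2)[OF True assms] by linarith
next
  case False
  have "real (c n \<omega>) / N n \<le> (real (c n \<omega>) + 1) / N n" by (simp add: divide_right_mono)
  then show ?thesis using cell_nested(1)[of m n, OF _ assms] False by linarith
qed

lemma \<Phi>_bounds:
  assumes "\<omega> \<in> space M"
  shows "real (c n \<omega>) / N n \<le> \<Phi> \<omega>" "\<Phi> \<omega> \<le> (real (c n \<omega>) + 1) / N n"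
proof -
  have "bdd_above (range (\<lambda>n. real (c n \<omega>) / N n))"
    using c_le_c[OF assms, of _ 0] by (intro bdd_aboveI) blast
  then show "real (c n \<omega>) / N n \<le> \<Phi> \<omega>" unfolding \<Phi>_def by (intro cSUP_upper) auto
  show "\<Phi> \<omega> \<le> (real (c n \<omega>) + 1) / N n"
    unfolding \<Phi>_def using c_le_c[OF assms] by (intro cSUP_least) auto
qed

lemma \<Phi>_measurable [measurable]: "\<Phi> \<in> borel_measurable M"
  unfolding \<Phi>_def
proof (rule borel_measurable_cSUP)
  fix \<omega> assume "\<omega> \<in> space M"
  then show "bdd_above (range (\<lambda>n. real (c n \<omega>) / N n))"
    using c_le_c[of _ _ 0] by (intro bdd_aboveI) blast
qed auto

lemma \<Phi>_ge_0: "\<omega> \<in> space M \<Longrightarrow> 0 \<le> \<Phi> \<omega>"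
  using \<Phi>_bounds(1)[of \<omega> 0] by (meson divide_nonneg_nonneg of_nat_0_le_iff order_trans)

lemma \<Phi>_le_1: "\<omega> \<in> space M \<Longrightarrow> \<Phi> \<omega> \<le> 1"
proof -
  assume \<omega>: "\<omega> \<in> space M"
  have "(real (c 0 \<omega>) + 1) / N 0 \<le> 1"
    using c_less[OF \<omega>, of 0] N_pos[of 0] by (simp add: field_simps)
  then show ?thesis using \<Phi>_bounds(2)[OF \<omega>, of 0] by linarith
qed

text \<open>On each level the distribution function is squeezed between the measures of the cells lying entirely
  to the left of \<open>x\<close> and of those meeting \<open>(-\<infinity>, x]\<close>, which differ by one cell.\<close>

lemma distr_\<Phi>: "distr M borel \<Phi> = uniform01"
proof (rule cdf_unique)
  show "real_distribution (distr M borel \<Phi>)" by (rule real_distribution_distr) simp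
  show "real_distribution uniform01"
    using prob_space_uniform01 by (simp add: real_distribution_def real_distribution_axioms_def)
  show "cdf (distr M borel \<Phi>) = cdf uniform01"
  proof
    fix x :: real
    have cdf: "cdf (distr M borel \<Phi>) x = prob {\<omega> \<in> space M. \<Phi> \<omega> \<le> x}"
      by (simp add: cdf_def measure_distr vimage_def Int_def conj_commute)
    consider "x < 0" | "1 \<le> x" | "0 \<le> x" "x < 1" by linarith
    then show "cdf (distr M borel \<Phi>) x = cdf uniform01 x"
    proof cases
      case 1
      then have "{\<omega> \<in> space M. \<Phi> \<omega> \<le> x} = {}" using \<Phi>_ge_0 by force
      then have "prob {\<omega> \<in> space M. \<Phi> \<omega> \<le> x} = 0" by (simp only: measure_empty)
      then show ?thesis using 1 by (simp add: cdf cdf_uniform01)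
    next
      case 2
      then have "{\<omega> \<in> space M. \<Phi> \<omega> \<le> x} = space M" using \<Phi>_le_1 by force
      then have "prob {\<omega> \<in> space M. \<Phi> \<omega> \<le> x} = 1" by (simp only: prob_space)
      then show ?thesis using 2 by (simp add: cdf cdf_uniform01)
    next
      case 3
      have "\<bar>prob {\<omega> \<in> space M. \<Phi> \<omega> \<le> x} - x\<bar> \<le> 1 / N n" for n
      proof -
        define k where "k = nat \<lfloor>N n * x\<rfloor>"
        have k: "real k \<le> N n * x" "N n * x < real k + 1"
          using 3 by (auto simp: k_def)
        have "N n * x < N n" using 3 N_pos[of n] by simp
        then have "k < N n" using k by linarith
        have "{\<omega> \<in> space M. c n \<omega> \<in> {..<k}} \<subseteq> {\<omega> \<in> space M. \<Phi> \<omega> \<le> x}"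
        proof safe
          fix \<omega> assume \<omega>: "\<omega> \<in> space M" "c n \<omega> < k"
          then have "(real (c n \<omega>) + 1) / N n \<le> real k / N n" by (intro divide_right_mono) auto
          also have "\<dots> \<le> x" using k N_pos[of n] by (simp add: field_simps)
          finally show "\<Phi> \<omega> \<le> x" using \<Phi>_bounds(2)[OF \<omega>(1), of n] by linarith
        qed
        then have "prob {\<omega> \<in> space M. c n \<omega> \<in> {..<k}} \<le> prob {\<omega> \<in> space M. \<Phi> \<omega> \<le> x}"
          by (intro finite_measure_mono) auto
        then have 1: "real k / N n \<le> prob {\<omega> \<in> space M. \<Phi> \<omega> \<le> x}"
          using \<open>k < N n\<close> by (subst (asm) prob_cells) auto
        have "{\<omega> \<in> space M. \<Phi> \<omega> \<le> x} \<subseteq> {\<omega> \<in> space M. c n \<omega> \<in> {..k}}"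
        proof safe
          fix \<omega> assume \<omega>: "\<omega> \<in> space M" "\<Phi> \<omega> \<le> x"
          then have "real (c n \<omega>) / N n \<le> x" using \<Phi>_bounds(1)[OF \<omega>(1), of n] by linarith
          then have "real (c n \<omega>) \<le> N n * x" using N_pos[of n] by (simp add: field_simps)
          then show "c n \<omega> \<le> k" using k by linarith
        qed
        then have "prob {\<omega> \<in> space M. \<Phi> \<omega> \<le> x} \<le> prob {\<omega> \<in> space M. c n \<omega> \<in> {..k}}"
          by (intro finite_measure_mono) auto
        then have 2: "prob {\<omega> \<in> space M. \<Phi> \<omega> \<le> x} \<le> (real k + 1) / N n"
          using \<open>k < N n\<close> by (subst (asm) prob_cells) (auto simp: add.commute)
        have "real k / N n \<le> x" "x \<le> (real k + 1) / N n"
          using k N_pos[of n] by (auto simp: field_simps)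
        moreover have "(real k + 1) / N n = real k / N n + 1 / N n" by (simp add: add_divide_distrib)
        ultimately show ?thesis using 1 2 by linarith
      qed
      moreover have "1 / N (Suc n) \<le> inverse (real (Suc n))" for n
        using N_ge[of "Suc n"] by (simp add: inverse_eq_divide frac_le del: of_nat_Suc)
      ultimately have "\<bar>prob {\<omega> \<in> space M. \<Phi> \<omega> \<le> x} - x\<bar> \<le> inverse (real (Suc n))" for n
        using order_trans by blast
      then have "\<bar>prob {\<omega> \<in> space M. \<Phi> \<omega> \<le> x} - x\<bar> \<le> 0"
        using LIMSEQ_le_const[OF LIMSEQ_inverse_real_of_nat] by blast
      then show ?thesis using 3 by (simp add: cdf cdf_uniform01)
    qed
  qed
qed

text \<open>The sets that do not separate two given points form a \<open>\<sigma>\<close>-algebra; if it contained all cells, it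
  would contain the singletons.\<close>

lemma cells_separate_points:
  assumes "\<omega> \<in> space M" "\<omega>' \<in> space M" "\<And>n. c n \<omega> = c n \<omega>'"
  shows "\<omega> = \<omega>'"
proof -
  have "\<omega> \<in> A \<longleftrightarrow> \<omega>' \<in> A" if "A \<in> sigma_sets (space M) {{\<omega> \<in> space M. c n \<omega> = k} | n k. True}" for A
    using that by induction (use assms in auto)
  then have "\<omega> \<in> {\<omega>'} \<longleftrightarrow> \<omega>' \<in> {\<omega>'}"
    using singleton_in_standard_borel[OF standard assms(2)] unfolding generate by blast
  then show ?thesis by simp
qed

text \<open>The numbers that may have two digit expansions: only over them can \<open>\<Phi>\<close> identify points or disagree with the
  cell index read off from the digits.\<close>

definition endpoints :: "real set" where
  "endpoints = (\<Union>m. range (\<lambda>j::nat. real j / N m))"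

lemma countable_endpoints: "countable endpoints"
  unfolding endpoints_def by auto

lemma c_eq_floor:
  assumes "\<omega> \<in> space M" "\<Phi> \<omega> \<notin> endpoints"
  shows "c m \<omega> = nat \<lfloor>N m * \<Phi> \<omega>\<rfloor>"
proof -
  have "\<Phi> \<omega> \<noteq> real (Suc (c m \<omega>)) / N m" using assms(2) unfolding endpoints_def by blast
  then have "\<Phi> \<omega> < (real (c m \<omega>) + 1) / N m"
    using \<Phi>_bounds(2)[OF assms(1), of m] by (simp add: add.commute)
  then have "\<lfloor>N m * \<Phi> \<omega>\<rfloor> = int (c m \<omega>)"
    using \<Phi>_bounds(1)[OF assms(1), of m] N_pos[of m] by (simp add: floor_eq_iff field_simps)
  then show ?thesis by simp
qed

lemma \<Phi>_inj:
  assumes "\<omega> \<in> space M" "\<omega>' \<in> space M" "\<Phi> \<omega> = \<Phi> \<omega>'" "\<Phi> \<omega> \<notin> endpoints"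
  shows "\<omega> = \<omega>'"
  using assms c_eq_floor cells_separate_points by metis

text \<open>The map is \<open>\<Psi> \<circ> T \<circ> \<Phi>\<close>, where \<open>T\<close> is the interval exchange of \<open>\<sigma>\<close> and \<open>\<Psi>\<close> a measurable inverse of
  \<open>\<Phi>\<close> on a Borel set of full measure. On the remaining null set it is made constant on each cell, so
  that the action on the cells holds everywhere and not just almost everywhere.\<close>

lemma cell_permuting_map:
  assumes \<sigma>: "\<sigma> permutes {..<N n}"
  obtains g where "g \<in> mp_maps M" "\<And>\<omega>. \<omega> \<in> space M \<Longrightarrow> c n (g \<omega>) = \<sigma> (c n \<omega>)"
proof -
  obtain E where E: "E \<in> sets borel" "E \<subseteq> \<Phi> ` space M" "emeasure M (space M - \<Phi> -` E) = 0"
    using standard_borel_image_full[OF standard finite_measure_axioms \<Phi>_measurable] by blast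
  define G where "G = E - endpoints"
  have [measurable]: "G \<in> sets borel"
    unfolding G_def using E(1) countable_endpoints by (intro sets.Diff) (auto intro: sets.countable)
  obtain \<omega>\<^sub>0 where \<omega>\<^sub>0: "\<omega>\<^sub>0 \<in> space M" using not_empty by blast
  define \<Psi> where "\<Psi> = (\<lambda>t. if t \<in> G then inv_into (space M) \<Phi> t else \<omega>\<^sub>0)"
  have \<Psi>_space: "\<Psi> t \<in> space M" for t
  proof (cases "t \<in> G")
    case True
    then show ?thesis using E(2) by (auto simp: \<Psi>_def G_def intro: inv_into_into)
  next
    case False
    then show ?thesis using \<omega>\<^sub>0 by (auto simp: \<Psi>_def)
  qed
  have \<Phi>_\<Psi>: "\<Phi> (\<Psi> t) = t" if "t \<in> G" for t
    using that E(2) by (auto simp: \<Psi>_def G_def intro: f_inv_into_f)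
  have c_\<Psi>: "c m (\<Psi> t) = nat \<lfloor>N m * t\<rfloor>" if "t \<in> G" for m and t :: real
    using c_eq_floor[OF \<Psi>_space, of t m] \<Phi>_\<Psi>[OF that] that by (simp add: G_def)
  have \<Psi>_\<Phi>: "\<Psi> (\<Phi> \<omega>) = \<omega>" if "\<omega> \<in> space M" "\<Phi> \<omega> \<in> G" for \<omega>
    using \<Phi>_inj[OF \<Psi>_space that(1)] \<Phi>_\<Psi>[OF that(2)] that by (simp add: G_def)
  have [measurable]: "\<Psi> \<in> borel \<rightarrow>\<^sub>M M"
  proof (rule measurable_sigma_sets[OF generate])
    fix A assume "A \<in> {{\<omega> \<in> space M. c n \<omega> = k} | n k. True}"
    then obtain m k where A: "A = {\<omega> \<in> space M. c m \<omega> = k}" by blast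
    have "\<Psi> -` A \<inter> space borel
      = {t :: real. if t \<in> G then nat \<lfloor>N m * t\<rfloor> = k else c m \<omega>\<^sub>0 = k}"
      using \<Psi>_space c_\<Psi> by (auto simp: A) (auto simp: \<Psi>_def)
    also have "\<dots> \<in> sets borel" by measurable
    finally show "\<Psi> -` A \<inter> space borel \<in> sets borel" .
  qed (use \<Psi>_space in auto)
  let ?T = "interval_exchange (N n) \<sigma>"
  have AE_G: "AE t in uniform01. t \<in> G"
  proof -
    have "AE \<omega> in M. \<Phi> \<omega> \<in> E"
    proof (rule AE_I[OF _ E(3)])
      have "space M - (\<Phi> -` E \<inter> space M) \<in> sets M"
        using measurable_sets[OF \<Phi>_measurable E(1)] by blast
      also have "space M - (\<Phi> -` E \<inter> space M) = space M - \<Phi> -` E" by auto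
      finally show "space M - \<Phi> -` E \<in> sets M" .
    qed auto
    then have 1: "AE t in uniform01. t \<in> E"
      unfolding distr_\<Phi>[symmetric] using E(1) by (subst AE_distr_iff) auto
    have "emeasure uniform01 endpoints = 0"
    proof -
      have "emeasure uniform01 endpoints \<le> emeasure lborel endpoints"
        using sets.countable[OF _ countable_endpoints]
        by (subst emeasure_uniform01) (auto intro!: emeasure_mono)
      then show ?thesis using emeasure_lborel_countable[OF countable_endpoints] by simp
    qed
    then have 2: "AE t in uniform01. t \<notin> endpoints"
      using sets.countable[OF _ countable_endpoints]
      by (intro AE_I[of _ _ endpoints]) auto
    show ?thesis using 1 2 by eventually_elim (simp add: G_def)
  qed
  have "AE t in distr uniform01 borel ?T. t \<in> G"
    unfolding distr_interval_exchange[OF N_pos \<sigma>] by (rule AE_G)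
  then have "AE t in uniform01. ?T t \<in> G"
    by (subst (asm) AE_distr_iff) auto
  with AE_G have "AE t in distr M borel \<Phi>. t \<in> G \<and> ?T t \<in> G"
    unfolding distr_\<Phi> by auto
  then have AE_W: "AE \<omega> in M. \<Phi> \<omega> \<in> G \<and> ?T (\<Phi> \<omega>) \<in> G"
    by (subst (asm) AE_distr_iff) auto
  define W where "W = {\<omega> \<in> space M. \<Phi> \<omega> \<in> G \<and> ?T (\<Phi> \<omega>) \<in> G}"
  have W[measurable]: "W \<in> sets M" unfolding W_def by measurable
  define b where "b = (\<lambda>k. SOME \<omega>. \<omega> \<in> space M \<and> c n \<omega> = k)"
  have b: "b k \<in> space M \<and> c n (b k) = k" if "k < N n" for k
  proof -
    have "prob {\<omega> \<in> space M. c n \<omega> = k} \<noteq> 0" using prob_cell[OF that] N_pos[of n] by simp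
    then have "{\<omega> \<in> space M. c n \<omega> = k} \<noteq> {}"
      by (rule contrapos_nn) (simp only: measure_empty)
    then have "\<exists>\<omega>. \<omega> \<in> space M \<and> c n \<omega> = k" by blast
    then show ?thesis unfolding b_def by (rule someI_ex)
  qed
  define g where "g = (\<lambda>\<omega>. if \<omega> \<in> W then \<Psi> (?T (\<Phi> \<omega>)) else b (\<sigma> (c n \<omega>)))"
  have \<sigma>_less: "\<sigma> (c n \<omega>) < N n" if "\<omega> \<in> space M" for \<omega>
    using permutes_in_image[OF \<sigma>, of "c n \<omega>"] c_less[OF that] by simp
  have c_g: "c n (g \<omega>) = \<sigma> (c n \<omega>)" if \<omega>: "\<omega> \<in> space M" for \<omega>
  proof (cases "\<omega> \<in> W")
    case True
    then have G: "\<Phi> \<omega> \<in> G" "?T (\<Phi> \<omega>) \<in> G" by (auto simp: W_def)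
    have c: "c n \<omega> = nat \<lfloor>N n * \<Phi> \<omega>\<rfloor>" using c_eq_floor[OF \<omega>] G by (simp add: G_def)
    have nn: "0 \<le> N n * \<Phi> \<omega>" using \<Phi>_ge_0[OF \<omega>] by simp
    have "N n * ?T (\<Phi> \<omega>) = N n * \<Phi> \<omega> + (real (\<sigma> (c n \<omega>)) - real (c n \<omega>))"
      using N_pos[of n] unfolding interval_exchange_def c[symmetric] by (simp add: field_simps)
    also have "\<dots> = N n * \<Phi> \<omega> + of_int (int (\<sigma> (c n \<omega>)) - int (c n \<omega>))" by simp
    finally have "\<lfloor>N n * ?T (\<Phi> \<omega>)\<rfloor> = \<lfloor>N n * \<Phi> \<omega>\<rfloor> + (int (\<sigma> (c n \<omega>)) - int (c n \<omega>))"
      by (simp only: floor_add_int)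
    then have "\<lfloor>N n * ?T (\<Phi> \<omega>)\<rfloor> = int (\<sigma> (c n \<omega>))" using c nn by simp
    then show ?thesis using True c_\<Psi>[OF G(2)] by (simp add: g_def)
  next
    case False
    then show ?thesis using b[OF \<sigma>_less[OF \<omega>]] by (simp add: g_def)
  qed
  have g_space: "g \<omega> \<in> space M" if "\<omega> \<in> space M" for \<omega>
    using \<Psi>_space b[OF \<sigma>_less[OF that]] by (simp add: g_def)
  have g_meas [measurable]: "g \<in> M \<rightarrow>\<^sub>M M"
  proof (rule measurable_sigma_sets[OF generate])
    fix A assume "A \<in> {{\<omega> \<in> space M. c n \<omega> = k} | n k. True}"
    then obtain m k where A: "A = {\<omega> \<in> space M. c m \<omega> = k}" by blast
    have "g -` A \<inter> space M = {\<omega> \<in> space M. c m (g \<omega>) = k}"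
      using g_space by (auto simp: A)
    also have "\<dots>
      = {\<omega> \<in> space M. if \<omega> \<in> W then c m (\<Psi> (?T (\<Phi> \<omega>))) = k else c m (b (\<sigma> (c n \<omega>))) = k}"
      unfolding g_def by (rule Collect_cong) (simp split: if_split)
    also have "\<dots> \<in> sets M" by measurable
    finally show "g -` A \<inter> space M \<in> sets M" .
  qed (use g_space in auto)
  have "distr M M g = distr M M (\<lambda>\<omega>. \<Psi> (?T (\<Phi> \<omega>)))"
  proof (rule distr_cong_AE)
    show "AE \<omega> in M. g \<omega> = \<Psi> (?T (\<Phi> \<omega>))"
      using AE_W AE_space by eventually_elim (simp add: g_def W_def)
  qed auto
  also have "\<dots> = distr (distr (distr M borel \<Phi>) borel ?T) M \<Psi>"
    by (simp add: distr_distr comp_def)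
  also have "\<dots> = distr (distr M borel \<Phi>) M \<Psi>"
    by (simp add: distr_\<Phi> distr_interval_exchange[OF N_pos \<sigma>])
  also have "\<dots> = distr M M (\<lambda>\<omega>. \<Psi> (\<Phi> \<omega>))"
    by (simp add: distr_distr comp_def)
  also have "\<dots> = distr M M (\<lambda>\<omega>. \<omega>)"
  proof (rule distr_cong_AE)
    show "AE \<omega> in M. \<Psi> (\<Phi> \<omega>) = \<omega>"
      using AE_W AE_space by eventually_elim (simp add: \<Psi>_\<Phi>)
  qed auto
  finally have "distr M M g = M" by simp
  moreover have "ess_injective M g"
    unfolding ess_injective_def
  proof (intro bexI conjI)
    have "AE \<omega> in M. \<omega> \<in> W" using AE_W AE_space by eventually_elim (simp add: W_def)
    then show "emeasure M (space M - W) = 0"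
      by (subst (asm) AE_iff_measurable[OF _ refl]) (auto simp: set_diff_eq)
    show "inj_on g W"
    proof (rule inj_onI)
      fix \<omega> \<omega>' assume *: "\<omega> \<in> W" "\<omega>' \<in> W" "g \<omega> = g \<omega>'"
      then have sp: "\<omega> \<in> space M" "\<omega>' \<in> space M" and G: "\<Phi> \<omega> \<in> G" "\<Phi> \<omega>' \<in> G"
        and T: "?T (\<Phi> \<omega>) \<in> G" "?T (\<Phi> \<omega>') \<in> G" by (auto simp: W_def)
      have "\<Psi> (?T (\<Phi> \<omega>)) = \<Psi> (?T (\<Phi> \<omega>'))" using * by (simp add: g_def)
      then have eqT: "?T (\<Phi> \<omega>) = ?T (\<Phi> \<omega>')" using \<Phi>_\<Psi>[OF T(1)] \<Phi>_\<Psi>[OF T(2)] by metis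
      have c: "c n \<omega> = nat \<lfloor>N n * \<Phi> \<omega>\<rfloor>" "c n \<omega>' = nat \<lfloor>N n * \<Phi> \<omega>'\<rfloor>"
        using c_eq_floor sp G by (auto simp: G_def)
      have "\<sigma> (c n \<omega>) = \<sigma> (c n \<omega>')" using c_g[OF sp(1)] c_g[OF sp(2)] *(3) by simp
      then have "c n \<omega> = c n \<omega>'" using permutes_inj[OF \<sigma>] by (auto dest: injD)
      then have "\<Phi> \<omega> = \<Phi> \<omega>'"
        using eqT unfolding interval_exchange_def c[symmetric] by simp
      then show "\<omega> = \<omega>'" using \<Phi>_inj[OF sp] G by (simp add: G_def)
    qed
  qed fact
  ultimately have "g \<in> mp_maps M" using g_meas by (simp add: mp_maps_def)
  then show thesis using that c_g by blast
qed

end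

section \<open>Permutations with prescribed counts\<close>

text \<open>\<open>None\<close> marks the elements left over.\<close>

lemma labelling_with_prescribed_counts:
  fixes n :: "'l \<Rightarrow> nat"
  assumes "finite F" "finite A" "(\<Sum>j\<in>F. n j) \<le> card A"
  shows "\<exists>z. (\<forall>k\<in>A. z k \<in> insert None (Some ` F)) \<and> (\<forall>j\<in>F. card {k\<in>A. z k = Some j} = n j)"
  using assms
proof (induction F arbitrary: A rule: finite_induct)
  case empty
  then show ?case by (intro exI[of _ "\<lambda>_. None"]) auto
next
  case (insert j F)
  then have "n j \<le> card A" by auto
  then obtain B where B: "B \<subseteq> A" "card B = n j"
    using obtain_subset_with_card_n by metis
  then have "finite B" using insert.prems finite_subset by auto
  then have "(\<Sum>j\<in>F. n j) \<le> card (A - B)"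
    using insert B by (simp add: card_Diff_subset)
  then obtain z where z: "\<And>k. k \<in> A - B \<Longrightarrow> z k \<in> insert None (Some ` F)"
    "\<And>j. j \<in> F \<Longrightarrow> card {k \<in> A - B. z k = Some j} = n j"
    using insert.IH[of "A - B"] insert.prems by auto
  define z' where "z' = (\<lambda>k. if k \<in> B then Some j else z k)"
  have "z' k \<in> insert None (Some ` insert j F)" if "k \<in> A" for k
    using that z(1)[of k] by (auto simp: z'_def)
  moreover have "card {k \<in> A. z' k = Some i} = n i" if "i \<in> insert j F" for i
  proof (cases "i = j")
    case True
    have "z k \<noteq> Some j" if "k \<in> A - B" for k
      using z(1)[OF that] insert.hyps by auto
    then have "{k \<in> A. z' k = Some i} = B"
      using B by (auto simp: z'_def True)
    then show ?thesis using B True by simp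
  next
    case False
    have "{k \<in> A. z' k = Some i} = {k \<in> A - B. z k = Some i}"
      using False by (auto simp: z'_def)
    then show ?thesis using z(2) that False by simp
  qed
  ultimately show ?case by blast
qed

text \<open>Both sides are labelled with pairs so that each pair \<open>(i, j)\<close> occurs exactly \<open>n i j\<close> times: on the
  source only where \<open>x = i\<close>, on the target only where \<open>y = j\<close>. The leftover counts agree as well, so
  the two labellings are equal as multisets and some permutation carries one to the other.\<close>

lemma permutation_with_prescribed_counts:
  fixes x :: "nat \<Rightarrow> 'l" and n :: "'l \<Rightarrow> 'm \<Rightarrow> nat" and y :: "nat \<Rightarrow> 'm"
  assumes "finite F" "finite G" "finite A"
    and x: "x ` A \<subseteq> F" and y: "y ` A \<subseteq> G"
    and row: "\<And>i. i \<in> F \<Longrightarrow> (\<Sum>j\<in>G. n i j) \<le> card {k\<in>A. x k = i}"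
    and col: "\<And>j. j \<in> G \<Longrightarrow> (\<Sum>i\<in>F. n i j) \<le> card {k\<in>A. y k = j}"
  shows "\<exists>\<sigma>. \<sigma> permutes A \<and> (\<forall>i\<in>F. \<forall>j\<in>G. n i j \<le> card {k\<in>A. x k = i \<and> y (\<sigma> k) = j})"
proof -
  have "\<exists>u. \<forall>i\<in>F. (\<forall>k\<in>{k\<in>A. x k = i}. u i k \<in> insert None (Some ` G)) \<and>
      (\<forall>j\<in>G. card {k\<in>{k\<in>A. x k = i}. u i k = Some j} = n i j)"
    by (intro bchoice ballI, rule labelling_with_prescribed_counts[OF assms(2) _ row])
      (use assms(3) in simp_all)
  then obtain u where u0: "\<forall>i\<in>F. (\<forall>k\<in>{k\<in>A. x k = i}. u i k \<in> insert None (Some ` G)) \<and>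
      (\<forall>j\<in>G. card {k\<in>{k\<in>A. x k = i}. u i k = Some j} = n i j)" ..
  have u: "u i k \<in> insert None (Some ` G)" if "i \<in> F" "k \<in> A" "x k = i" for i k
    using bspec[OF u0 that(1)] that(2,3) by simp
  have u_card: "card {k\<in>A. x k = i \<and> u i k = Some j} = n i j" if "i \<in> F" "j \<in> G" for i j
    using bspec[OF u0 that(1)] that(2) by simp
  have "\<exists>v. \<forall>j\<in>G. (\<forall>k\<in>{k\<in>A. y k = j}. v j k \<in> insert None (Some ` F)) \<and>
      (\<forall>i\<in>F. card {k\<in>{k\<in>A. y k = j}. v j k = Some i} = n i j)"
    by (intro bchoice ballI, rule labelling_with_prescribed_counts[OF assms(1) _ col])
      (use assms(3) in simp_all)
  then obtain v where v0: "\<forall>j\<in>G. (\<forall>k\<in>{k\<in>A. y k = j}. v j k \<in> insert None (Some ` F)) \<and>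
      (\<forall>i\<in>F. card {k\<in>{k\<in>A. y k = j}. v j k = Some i} = n i j)" ..
  have v: "v j k \<in> insert None (Some ` F)" if "j \<in> G" "k \<in> A" "y k = j" for j k
    using bspec[OF v0 that(1)] that(2,3) by simp
  have v_card: "card {k\<in>A. y k = j \<and> v j k = Some i} = n i j" if "i \<in> F" "j \<in> G" for i j
    using bspec[OF v0 that(2)] that(1) by simp
  define X where "X = (\<lambda>k. map_option (Pair (x k)) (u (x k) k))"
  define Y where "Y = (\<lambda>k. map_option (\<lambda>i. (i, y k)) (v (y k) k))"
  have X_range: "X k \<in> insert None (Some ` (F \<times> G))" if "k \<in> A" for k
    using u[of "x k" k] x that by (auto simp: X_def)
  have Y_range: "Y k \<in> insert None (Some ` (F \<times> G))" if "k \<in> A" for k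
    using v[of "y k" k] y that by (auto simp: Y_def)
  have X_card: "card {k\<in>A. X k = Some (i, j)} = n i j" if "i \<in> F" "j \<in> G" for i j
  proof -
    have "{k\<in>A. X k = Some (i, j)} = {k\<in>A. x k = i \<and> u i k = Some j}"
      by (auto simp: X_def)
    then show ?thesis using u_card[OF that] by (simp only:)
  qed
  have Y_card: "card {k\<in>A. Y k = Some (i, j)} = n i j" if "i \<in> F" "j \<in> G" for i j
  proof -
    have "{k\<in>A. Y k = Some (i, j)} = {k\<in>A. y k = j \<and> v j k = Some i}"
      by (auto simp: Y_def)
    then show ?thesis using v_card[OF that] by (simp only:)
  qed
  have none: "card {k\<in>A. W k = None} = card A - (\<Sum>(i, j)\<in>F \<times> G. n i j)"
    if W: "\<And>k. k \<in> A \<Longrightarrow> W k \<in> insert None (Some ` (F \<times> G))"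
      "\<And>i j. i \<in> F \<Longrightarrow> j \<in> G \<Longrightarrow> card {k\<in>A. W k = Some (i, j)} = n i j" for W
  proof -
    have fin: "finite (F \<times> G)" using assms by simp
    have "W ` A \<subseteq> insert None (Some ` (F \<times> G))" by (rule image_subsetI) (rule W(1))
    then have "card A = (\<Sum>l \<in> insert None (Some ` (F \<times> G)). card {k \<in> A. W k = l})"
      using sum_fun_comp[OF \<open>finite A\<close>, of "insert None (Some ` (F \<times> G))" W "\<lambda>_. 1::nat"] fin by simp
    also have "\<dots> = card {k\<in>A. W k = None} + (\<Sum>l \<in> F \<times> G. card {k \<in> A. W k = Some l})"
      using fin by (subst sum.insert) (auto simp: sum.reindex)
    also have "(\<Sum>l \<in> F \<times> G. card {k \<in> A. W k = Some l}) = (\<Sum>(i, j)\<in>F \<times> G. n i j)"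
      using W(2) by (intro sum.cong) auto
    finally show ?thesis by simp
  qed
  have "image_mset X (mset_set A) = image_mset Y (mset_set A)"
  proof (rule multiset_eqI)
    fix l
    have cnt: "count (image_mset W (mset_set A)) l = card {k\<in>A. W k = l}" for W :: "nat \<Rightarrow> ('l \<times> 'm) option"
      using \<open>finite A\<close> by (simp add: count_image_mset vimage_def Int_def conj_commute)
    have "card {k\<in>A. X k = l} = card {k\<in>A. Y k = l}"
    proof (cases l)
      case None
      then show ?thesis using none[OF X_range X_card] none[OF Y_range Y_card] by simp
    next
      case (Some ij)
      show ?thesis
      proof (cases "ij \<in> F \<times> G")
        case True
        then show ?thesis using X_card Y_card Some by (cases ij) auto
      next
        case False
        then have "{k\<in>A. X k = l} = {}" "{k\<in>A. Y k = l} = {}"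
          using X_range Y_range Some by fastforce+
        then show ?thesis by (simp only:)
      qed
    qed
    then show "count (image_mset X (mset_set A)) l = count (image_mset Y (mset_set A)) l"
      by (simp add: cnt)
  qed
  then obtain \<sigma> where \<sigma>: "\<sigma> permutes A" "\<And>k. k \<in> A \<Longrightarrow> X k = Y (\<sigma> k)"
    using image_mset_eq_implies_permutes[OF \<open>finite A\<close>] by metis
  have "n i j \<le> card {k\<in>A. x k = i \<and> y (\<sigma> k) = j}" if "i \<in> F" "j \<in> G" for i j
  proof -
    have "X k = Some (i, j) \<Longrightarrow> k \<in> A \<Longrightarrow> x k = i \<and> y (\<sigma> k) = j" for k
      using \<sigma>(2)[of k] by (cases "v (y (\<sigma> k)) (\<sigma> k)") (auto simp: X_def Y_def)
    then have "card {k\<in>A. X k = Some (i, j)} \<le> card {k\<in>A. x k = i \<and> y (\<sigma> k) = j}"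
      using \<open>finite A\<close> by (intro card_mono) auto
    then show ?thesis using X_card[OF that] by simp
  qed
  then show ?thesis using \<sigma>(1) by blast
qed

section \<open>Realising a coupling of finitely many labels\<close>

lemma pred_label_eq:
  assumes u: "u \<in> M \<rightarrow>\<^sub>M count_space F"
  shows "Measurable.pred M (\<lambda>\<omega>. u \<omega> = i)"
  using measurable_compose[OF u, of "\<lambda>a. a = i"] by auto

lemma pred_label_neq:
  assumes "finite F" and u: "u \<in> M \<rightarrow>\<^sub>M count_space F" and c: "c \<in> M \<rightarrow>\<^sub>M count_space UNIV"
  shows "Measurable.pred M (\<lambda>\<omega>. u \<omega> \<noteq> z (c \<omega>))"
proof -
  have "{\<omega> \<in> space M. u \<omega> \<noteq> z (c \<omega>)} = (\<Union>i\<in>F. {\<omega> \<in> space M. u \<omega> = i \<and> z (c \<omega>) \<noteq> i})"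
    using measurable_space[OF u] by auto
  also have "\<dots> \<in> sets M"
  proof (intro sets.finite_UN \<open>finite F\<close>)
    fix i
    show "{\<omega> \<in> space M. u \<omega> = i \<and> z (c \<omega>) \<noteq> i} \<in> sets M"
      using pred_intros_logic(3)[OF pred_label_eq[OF u, of i] c[THEN measurable_compose, of "\<lambda>a. z a \<noteq> i" "count_space UNIV"]]
      by (simp add: pred_def)
  qed
  finally show ?thesis by (simp add: pred_def)
qed

text \<open>Subtracting \<open>\<delta>\<close> from every entry and truncating at zero lowers the total by at least \<open>\<delta>\<close>, unless
  nothing remains. This makes room for an error of \<open>\<delta>\<close> in the row and column sums.\<close>

lemma sum_truncated_le:
  fixes w :: "'l \<Rightarrow> real"
  assumes "finite G" "\<And>j. j \<in> G \<Longrightarrow> 0 \<le> w j" "(\<Sum>j\<in>G. w j) \<le> p + \<delta>" "0 \<le> p" "0 \<le> \<delta>"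
  shows "(\<Sum>j\<in>G. max 0 (w j - \<delta>)) \<le> p"
proof (cases "\<exists>j\<in>G. \<delta> < w j")
  case True
  then obtain j where j: "j \<in> G" "\<delta> < w j" by blast
  have "(\<Sum>j\<in>G. max 0 (w j - \<delta>)) = (w j - \<delta>) + (\<Sum>j\<in>G - {j}. max 0 (w j - \<delta>))"
    using j assms(1) by (subst sum.remove[of G j]) auto
  also have "\<dots> \<le> (w j - \<delta>) + (\<Sum>j\<in>G - {j}. w j)"
    using assms by (intro add_left_mono sum_mono) (auto simp: max_def)
  also have "\<dots> = (\<Sum>j\<in>G. w j) - \<delta>"
    using j assms(1) by (simp add: sum.remove[of G j])
  finally show ?thesis using assms(3) by linarith
next
  case False
  then have "(\<Sum>j\<in>G. max 0 (w j - \<delta>)) = 0" by (intro sum.neutral) auto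
  then show ?thesis using assms(4) by simp
qed

context refining_partitions
begin

text \<open>The sets that can be approximated in measure by unions of cells, on every sufficiently fine level,
  form a \<open>\<sigma>\<close>-algebra. In the set-builder the equivalence with a negation is the symmetric difference.\<close>

lemma approx_set_by_cells:
  assumes "A \<in> sets M" "0 < \<delta>"
  shows "\<exists>n0. \<forall>n\<ge>n0. \<exists>J\<subseteq>{..<N n}. prob {\<omega> \<in> space M. \<omega> \<in> A \<longleftrightarrow> c n \<omega> \<notin> J} \<le> \<delta>"
proof -
  have sets: "B \<in> sets M" if "B \<in> sigma_sets (space M) {{\<omega> \<in> space M. c n \<omega> = k} | n k. True}" for B
    using that generate by blast
  have "A \<in> sigma_sets (space M) {{\<omega> \<in> space M. c n \<omega> = k} | n k. True}"
    using assms(1) generate by blast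
  then show ?thesis
    using assms(2)
  proof (induction arbitrary: \<delta>)
    case (Basic A)
    then obtain m k where A: "A = {\<omega> \<in> space M. c m \<omega> = k}" by blast
    have "prob {\<omega> \<in> space M. \<omega> \<in> A \<longleftrightarrow> c n \<omega> \<notin> {l. l < N n \<and> l div (N n div N m) = k}} \<le> \<delta>" if "n \<ge> m" for n
    proof -
      have "{\<omega> \<in> space M. \<omega> \<in> A \<longleftrightarrow> c n \<omega> \<notin> {l. l < N n \<and> l div (N n div N m) = k}} = {}"
        using c_refine[OF that] c_less by (auto simp: A)
      then show ?thesis using Basic(2) by (simp only: measure_empty)
    qed
    then show ?case
      by (intro exI[of _ m] allI impI exI[of _ "{l. l < N _ \<and> l div (N _ div N m) = k}"] conjI) auto
  next
    case Empty
    have "{\<omega> \<in> space M. \<omega> \<in> {} \<longleftrightarrow> c n \<omega> \<notin> {}} = {}" for n by auto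
    then have "prob {\<omega> \<in> space M. \<omega> \<in> {} \<longleftrightarrow> c n \<omega> \<notin> {}} \<le> \<delta>" for n
      using Empty by (simp only: measure_empty)
    then show ?case by (intro exI[of _ 0] allI impI exI[of _ "{}"]) auto
  next
    case (Compl A)
    obtain n0 where n0: "\<And>n. n \<ge> n0 \<Longrightarrow>
        \<exists>J\<subseteq>{..<N n}. prob {\<omega> \<in> space M. \<omega> \<in> A \<longleftrightarrow> c n \<omega> \<notin> J} \<le> \<delta>"
      using Compl.IH[OF Compl.prems] by blast
    have "\<exists>J\<subseteq>{..<N n}. prob {\<omega> \<in> space M. \<omega> \<in> space M - A \<longleftrightarrow> c n \<omega> \<notin> J} \<le> \<delta>" if n: "n \<ge> n0" for n
    proof -
      obtain J where J: "J \<subseteq> {..<N n}" "prob {\<omega> \<in> space M. \<omega> \<in> A \<longleftrightarrow> c n \<omega> \<notin> J} \<le> \<delta>"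
        using n0[OF n] by blast
      have "{\<omega> \<in> space M. \<omega> \<in> space M - A \<longleftrightarrow> c n \<omega> \<notin> {..<N n} - J}
          = {\<omega> \<in> space M. \<omega> \<in> A \<longleftrightarrow> c n \<omega> \<notin> J}"
        using c_less by auto
      then show ?thesis using J(2) by (intro exI[of _ "{..<N n} - J"]) auto
    qed
    then show ?case by blast
  next
    case (Union A)
    note [measurable] = sets[OF Union.hyps]
    have "(\<lambda>k. prob (\<Union>i<k. A i)) \<longlonglongrightarrow> prob (\<Union>k. \<Union>i<k. A i)"
      by (rule finite_Lim_measure_incseq) (auto simp: incseq_def intro: less_le_trans)
    also have "(\<Union>k. \<Union>i<k. A i) = (\<Union>i. A i)" by auto
    finally have "\<forall>\<^sub>F k in sequentially. prob (\<Union>i. A i) - \<delta> / 2 < prob (\<Union>i<k. A i)"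
      using \<open>0 < \<delta>\<close> by (intro order_tendstoD) auto
    then obtain k where k: "prob (\<Union>i. A i) - \<delta> / 2 < prob (\<Union>i<k. A i)"
      using eventually_happens'[OF sequentially_bot] by blast
    have "prob ((\<Union>i. A i) - (\<Union>i<k. A i)) = prob (\<Union>i. A i) - prob (\<Union>i<k. A i)"
      by (rule finite_measure_Diff) auto
    with k have tail: "prob ((\<Union>i. A i) - (\<Union>i<k. A i)) \<le> \<delta> / 2" by linarith
    have "0 < \<delta> / (2 * Suc k)" using \<open>0 < \<delta>\<close> by (simp del: of_nat_Suc)
    then have "\<exists>n0. \<forall>i. \<forall>n\<ge>n0 i. \<exists>J\<subseteq>{..<N n}.
        prob {\<omega> \<in> space M. \<omega> \<in> A i \<longleftrightarrow> c n \<omega> \<notin> J} \<le> \<delta> / (2 * Suc k)"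
      by (intro choice allI Union.IH)
    then obtain n0 where n0: "\<forall>i. \<forall>n\<ge>n0 i. \<exists>J\<subseteq>{..<N n}.
        prob {\<omega> \<in> space M. \<omega> \<in> A i \<longleftrightarrow> c n \<omega> \<notin> J} \<le> \<delta> / (2 * Suc k)" ..
    have "\<exists>J\<subseteq>{..<N n}. prob {\<omega> \<in> space M. \<omega> \<in> (\<Union>i. A i) \<longleftrightarrow> c n \<omega> \<notin> J} \<le> \<delta>"
      if n: "n \<ge> (\<Sum>i<k. n0 i)" for n
    proof -
      have n0_le: "n0 i \<le> n" if "i < k" for i
        using n member_le_sum[of i "{..<k}" n0] that by auto
      have "\<exists>J. \<forall>i\<in>{..<k}. J i \<subseteq> {..<N n} \<and>
          prob {\<omega> \<in> space M. \<omega> \<in> A i \<longleftrightarrow> c n \<omega> \<notin> J i} \<le> \<delta> / (2 * Suc k)"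
      proof (intro bchoice ballI)
        fix i assume "i \<in> {..<k}"
        then show "\<exists>J\<subseteq>{..<N n}.
            prob {\<omega> \<in> space M. \<omega> \<in> A i \<longleftrightarrow> c n \<omega> \<notin> J} \<le> \<delta> / (2 * Suc k)"
          using n0[rule_format, OF n0_le[of i]] by simp
      qed
      then obtain J where "\<forall>i\<in>{..<k}. J i \<subseteq> {..<N n} \<and>
          prob {\<omega> \<in> space M. \<omega> \<in> A i \<longleftrightarrow> c n \<omega> \<notin> J i} \<le> \<delta> / (2 * Suc k)" ..
      then have J: "\<forall>i\<in>{..<k}. J i \<subseteq> {..<N n}" "\<forall>i\<in>{..<k}.
          prob {\<omega> \<in> space M. \<omega> \<in> A i \<longleftrightarrow> c n \<omega> \<notin> J i} \<le> \<delta> / (2 * Suc k)"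
        by simp_all
      define S where "S = (\<lambda>i. {\<omega> \<in> space M. \<omega> \<in> A i \<longleftrightarrow> c n \<omega> \<notin> J i})"
      have [measurable]: "S i \<in> sets M" for i unfolding S_def by measurable
      have "prob {\<omega> \<in> space M. \<omega> \<in> (\<Union>i. A i) \<longleftrightarrow> c n \<omega> \<notin> (\<Union>i<k. J i)}
          \<le> prob (((\<Union>i. A i) - (\<Union>i<k. A i)) \<union> (\<Union>i<k. S i))"
        by (intro finite_measure_mono) (auto simp: S_def)
      also have "\<dots> \<le> prob ((\<Union>i. A i) - (\<Union>i<k. A i)) + prob (\<Union>i<k. S i)"
        by (intro measure_Un_le) auto
      also have "prob (\<Union>i<k. S i) \<le> (\<Sum>i<k. prob (S i))"
        by (intro finite_measure_subadditive_finite) auto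
      also have "(\<Sum>i<k. prob (S i)) \<le> (\<Sum>i<k. \<delta> / (2 * Suc k))"
        using J(2) unfolding S_def by (intro sum_mono) blast
      also have "(\<Sum>i<k. \<delta> / (2 * Suc k)) \<le> \<delta> / 2"
        using \<open>0 < \<delta>\<close> by (simp add: field_simps)
      finally show ?thesis
        using tail J(1) by (intro exI[of _ "\<Union>i<k. J i"]) auto
    qed
    then show ?case by blast
  qed
qed

text \<open>Approximate each level set of \<open>u\<close> by a union of cells. Outside the symmetric differences the cell of
  \<open>\<omega>\<close> lies in exactly one of these unions, the one of the label \<open>u \<omega>\<close>.\<close>

lemma approx_label_by_cells:
  assumes "finite F" and u[measurable]: "u \<in> M \<rightarrow>\<^sub>M count_space F" and "0 < \<delta>"
  shows "\<exists>n0. \<forall>n\<ge>n0. \<exists>x. (\<forall>k. x k \<in> F) \<and> prob {\<omega> \<in> space M. u \<omega> \<noteq> x (c n \<omega>)} \<le> \<delta>"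
proof -
  have u_F: "u \<omega> \<in> F" if "\<omega> \<in> space M" for \<omega> using measurable_space[OF u that] by simp
  then have "F \<noteq> {}" using not_empty by blast
  then obtain i0 where "i0 \<in> F" by blast
  have "card F > 0" using \<open>finite F\<close> \<open>F \<noteq> {}\<close> by (simp add: card_gt_0_iff)
  have u_sets: "{\<omega> \<in> space M. u \<omega> = i} \<in> sets M" if "i \<in> F" for i
  proof -
    have "u -` {i} \<inter> space M \<in> sets M" using that by (intro measurable_sets[OF u]) auto
    then show ?thesis by (simp add: vimage_def Int_def conj_commute)
  qed
  have "0 < \<delta> / card F" using \<open>0 < \<delta>\<close> \<open>card F > 0\<close> by simp
  then have "\<exists>n0. \<forall>i\<in>F. \<forall>n\<ge>n0 i. \<exists>J\<subseteq>{..<N n}.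
      prob {\<omega> \<in> space M. \<omega> \<in> {\<omega> \<in> space M. u \<omega> = i} \<longleftrightarrow> c n \<omega> \<notin> J} \<le> \<delta> / card F"
    by (intro bchoice ballI approx_set_by_cells u_sets)
  then obtain n0 where n0: "\<forall>i\<in>F. \<forall>n\<ge>n0 i. \<exists>J\<subseteq>{..<N n}.
      prob {\<omega> \<in> space M. \<omega> \<in> {\<omega> \<in> space M. u \<omega> = i} \<longleftrightarrow> c n \<omega> \<notin> J} \<le> \<delta> / card F" ..
  have "\<exists>x. (\<forall>k. x k \<in> F) \<and> prob {\<omega> \<in> space M. u \<omega> \<noteq> x (c n \<omega>)} \<le> \<delta>"
    if n: "n \<ge> (\<Sum>i\<in>F. n0 i)" for n
  proof -
    have "n0 i \<le> n" if "i \<in> F" for i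
      using n member_le_sum[of i F n0] that \<open>finite F\<close> by auto
    then have "\<forall>i\<in>F. \<exists>J. prob {\<omega> \<in> space M. \<omega> \<in> {\<omega> \<in> space M. u \<omega> = i} \<longleftrightarrow> c n \<omega> \<notin> J} \<le> \<delta> / card F"
      using n0 by meson
    then have "\<exists>J. \<forall>i\<in>F. prob {\<omega> \<in> space M. \<omega> \<in> {\<omega> \<in> space M. u \<omega> = i} \<longleftrightarrow> c n \<omega> \<notin> J i} \<le> \<delta> / card F"
      by (rule bchoice)
    then obtain J where J: "\<forall>i\<in>F.
        prob {\<omega> \<in> space M. \<omega> \<in> {\<omega> \<in> space M. u \<omega> = i} \<longleftrightarrow> c n \<omega> \<notin> J i} \<le> \<delta> / card F" ..
    define S where "S = (\<lambda>i. {\<omega> \<in> space M. \<omega> \<in> {\<omega> \<in> space M. u \<omega> = i} \<longleftrightarrow> c n \<omega> \<notin> J i})"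
    have S[measurable]: "S i \<in> sets M" if "i \<in> F" for i
    proof -
      note [measurable] = u_sets[OF that]
      show ?thesis unfolding S_def by measurable
    qed
    define x where "x = (\<lambda>k. if \<exists>i\<in>F. k \<in> J i then SOME i. i \<in> F \<and> k \<in> J i else i0)"
    have x_F: "x k \<in> F" for k
      unfolding x_def using \<open>i0 \<in> F\<close> by (auto intro: someI2)
    have "{\<omega> \<in> space M. u \<omega> \<noteq> x (c n \<omega>)} \<subseteq> (\<Union>i\<in>F. S i)"
    proof (rule ccontr)
      assume "\<not> ?thesis"
      then obtain \<omega> where \<omega>: "\<omega> \<in> space M" "u \<omega> \<noteq> x (c n \<omega>)" "\<And>i. i \<in> F \<Longrightarrow> \<omega> \<notin> S i" by blast
      then have *: "u \<omega> = i \<longleftrightarrow> c n \<omega> \<in> J i" if "i \<in> F" for i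
        using that unfolding S_def by blast
      then have "(SOME i. i \<in> F \<and> c n \<omega> \<in> J i) = u \<omega>"
        using u_F[OF \<omega>(1)] by (intro some_equality) auto
      then have "x (c n \<omega>) = u \<omega>" using * u_F[OF \<omega>(1)] by (auto simp: x_def)
      then show False using \<omega>(2) by simp
    qed
    then have "prob {\<omega> \<in> space M. u \<omega> \<noteq> x (c n \<omega>)} \<le> prob (\<Union>i\<in>F. S i)"
      using \<open>finite F\<close> by (intro finite_measure_mono) auto
    also have "\<dots> \<le> (\<Sum>i\<in>F. prob (S i))"
      using \<open>finite F\<close> by (intro finite_measure_subadditive_finite) auto
    also have "\<dots> \<le> (\<Sum>i\<in>F. \<delta> / card F)"
      using J unfolding S_def by (intro sum_mono) blast
    also have "\<dots> = \<delta>" using \<open>card F > 0\<close> by simp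
    finally show ?thesis using x_F by blast
  qed
  then show ?thesis by blast
qed

text \<open>The labels are replaced by functions \<open>x\<close>, \<open>y\<close> of the cells, at the cost of \<open>\<delta>\<close> each. The masses
  \<open>w i j\<close>, lowered by \<open>\<delta>\<close> so that the rows and columns of cells can accommodate them and rounded down
  to multiples of the mass of a cell, are the counts realised by a permutation of the cells.\<close>

lemma coupling_lower_bound:
  fixes w :: "'l \<Rightarrow> 'm \<Rightarrow> real"
  assumes "finite F" "finite G" and u[measurable]: "u \<in> M \<rightarrow>\<^sub>M count_space F"
    and v[measurable]: "v \<in> M \<rightarrow>\<^sub>M count_space G"
    and w: "\<And>i j. i \<in> F \<Longrightarrow> j \<in> G \<Longrightarrow> 0 \<le> w i j"
    and row: "\<And>i. i \<in> F \<Longrightarrow> (\<Sum>j\<in>G. w i j) = prob {\<omega> \<in> space M. u \<omega> = i}"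
    and col: "\<And>j. j \<in> G \<Longrightarrow> (\<Sum>i\<in>F. w i j) = prob {\<omega> \<in> space M. v \<omega> = j}"
    and "0 < \<epsilon>"
  shows "\<exists>n0. \<forall>n\<ge>n0. \<exists>g\<in>mp_maps M. (\<exists>\<sigma>. \<forall>\<omega>\<in>space M. c n (g \<omega>) = \<sigma> (c n \<omega>)) \<and>
    (\<forall>i\<in>F. \<forall>j\<in>G. w i j - \<epsilon> \<le> prob {\<omega> \<in> space M. u \<omega> = i \<and> v (g \<omega>) = j})"
proof -
  \<comment> \<open>One \<open>\<delta>\<close> is lost by lowering \<open>w\<close>, one by rounding, and one by each of the two label approximations.\<close>
  define \<delta> where "\<delta> = \<epsilon> / 4"
  have \<delta>: "0 < \<delta>" using \<open>0 < \<epsilon>\<close> by (simp add: \<delta>_def)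
  note [measurable] = pred_label_eq[OF u] pred_label_eq[OF v]
    pred_label_neq[OF assms(1) u] pred_label_neq[OF assms(2) v]
  obtain n1 where n1: "\<forall>n\<ge>n1.
      \<exists>x. (\<forall>k. x k \<in> F) \<and> prob {\<omega> \<in> space M. u \<omega> \<noteq> x (c n \<omega>)} \<le> \<delta>"
    using approx_label_by_cells[OF assms(1) u \<delta>] ..
  obtain n2 where n2: "\<forall>n\<ge>n2.
      \<exists>y. (\<forall>k. y k \<in> G) \<and> prob {\<omega> \<in> space M. v \<omega> \<noteq> y (c n \<omega>)} \<le> \<delta>"
    using approx_label_by_cells[OF assms(2) v \<delta>] ..
  obtain n3 :: nat where n3: "1 / \<delta> < n3" using reals_Archimedean2 by blast
  have "\<exists>g\<in>mp_maps M. (\<exists>\<sigma>. \<forall>\<omega>\<in>space M. c n (g \<omega>) = \<sigma> (c n \<omega>)) \<and>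
    (\<forall>i\<in>F. \<forall>j\<in>G. w i j - \<epsilon> \<le> prob {\<omega> \<in> space M. u \<omega> = i \<and> v (g \<omega>) = j})"
    if n: "n \<ge> n1 + n2 + n3" for n
  proof -
    have "1 / \<delta> < N n" using n3 n N_ge[of n] by linarith
    then have N_large: "1 / N n < \<delta>" using \<delta> N_pos[of n] by (simp add: field_simps)
    obtain x where x: "\<And>k. x k \<in> F" "prob {\<omega> \<in> space M. u \<omega> \<noteq> x (c n \<omega>)} \<le> \<delta>"
      using n1[rule_format, of n] n by auto
    obtain y where y: "\<And>k. y k \<in> G" "prob {\<omega> \<in> space M. v \<omega> \<noteq> y (c n \<omega>)} \<le> \<delta>"
      using n2[rule_format, of n] n by auto
    define q where "q = (\<lambda>i j. nat \<lfloor>N n * max 0 (w i j - \<delta>)\<rfloor>)"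
    have q_le: "real (q i j) \<le> N n * max 0 (w i j - \<delta>)" for i j
      by (simp add: q_def)
    have q_ge: "N n * max 0 (w i j - \<delta>) - 1 \<le> real (q i j)" for i j
      unfolding q_def by linarith
    \<comment> \<open>the same estimate serves rows and columns\<close>
    have counts: "(\<Sum>j\<in>H. real (nat \<lfloor>N n * max 0 (r j - \<delta>)\<rfloor>)) \<le> card {k \<in> {..<N n}. z k = i}"
      if "finite H" "\<And>j. j \<in> H \<Longrightarrow> 0 \<le> r j" "(\<Sum>j\<in>H. r j) = prob {\<omega> \<in> space M. s \<omega> = i}"
        "prob {\<omega> \<in> space M. s \<omega> \<noteq> z (c n \<omega>)} \<le> \<delta>"
        "{\<omega> \<in> space M. s \<omega> \<noteq> z (c n \<omega>)} \<in> sets M"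
      for H :: "'h set" and r z i and s :: "'a \<Rightarrow> 'k"
    proof -
      have card: "prob {\<omega> \<in> space M. c n \<omega> \<in> {k \<in> {..<N n}. z k = i}} = card {k \<in> {..<N n}. z k = i} / N n"
        by (intro prob_cells) auto
      have "prob {\<omega> \<in> space M. s \<omega> = i}
          \<le> prob ({\<omega> \<in> space M. c n \<omega> \<in> {k \<in> {..<N n}. z k = i}} \<union> {\<omega> \<in> space M. s \<omega> \<noteq> z (c n \<omega>)})"
        using c_less that(5) by (intro finite_measure_mono) auto
      also have "\<dots> \<le> prob {\<omega> \<in> space M. c n \<omega> \<in> {k \<in> {..<N n}. z k = i}} + prob {\<omega> \<in> space M. s \<omega> \<noteq> z (c n \<omega>)}"
        using that(5) by (intro measure_Un_le) auto
      finally have "(\<Sum>j\<in>H. r j) \<le> card {k \<in> {..<N n}. z k = i} / N n + \<delta>"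
        using that(3,4) card by linarith
      then have "(\<Sum>j\<in>H. max 0 (r j - \<delta>)) \<le> card {k \<in> {..<N n}. z k = i} / N n"
        using that \<delta> by (intro sum_truncated_le) auto
      then have "N n * (\<Sum>j\<in>H. max 0 (r j - \<delta>)) \<le> card {k \<in> {..<N n}. z k = i}"
        using N_pos[of n] by (simp add: field_simps)
      moreover have "(\<Sum>j\<in>H. real (nat \<lfloor>N n * max 0 (r j - \<delta>)\<rfloor>)) \<le> (\<Sum>j\<in>H. N n * max 0 (r j - \<delta>))"
        by (intro sum_mono) simp
      ultimately show ?thesis by (simp add: sum_distrib_left)
    qed
    have "\<exists>\<sigma>. \<sigma> permutes {..<N n} \<and>
        (\<forall>i\<in>F. \<forall>j\<in>G. q i j \<le> card {k\<in>{..<N n}. x k = i \<and> y (\<sigma> k) = j})"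
    proof (rule permutation_with_prescribed_counts)
      show "(\<Sum>j\<in>G. q i j) \<le> card {k\<in>{..<N n}. x k = i}" if "i \<in> F" for i
      proof -
        have "real (\<Sum>j\<in>G. q i j) \<le> card {k\<in>{..<N n}. x k = i}"
          unfolding q_def of_nat_sum
          by (rule counts[OF assms(2) w[OF that] row[OF that] x(2)]) measurable
        then show ?thesis by (simp only: of_nat_le_iff)
      qed
      show "(\<Sum>i\<in>F. q i j) \<le> card {k\<in>{..<N n}. y k = j}" if "j \<in> G" for j
      proof -
        have "real (\<Sum>i\<in>F. q i j) \<le> card {k\<in>{..<N n}. y k = j}"
          unfolding q_def of_nat_sum
          by (rule counts[OF assms(1) w[OF _ that] col[OF that] y(2)]) measurable
        then show ?thesis by (simp only: of_nat_le_iff)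
      qed
    qed (use assms(1,2) x(1) y(1) in auto)
    then obtain \<sigma> where \<sigma>: "\<sigma> permutes {..<N n}"
      "\<And>i j. i \<in> F \<Longrightarrow> j \<in> G \<Longrightarrow> q i j \<le> card {k\<in>{..<N n}. x k = i \<and> y (\<sigma> k) = j}" by blast
    obtain g where g: "g \<in> mp_maps M" "\<And>\<omega>. \<omega> \<in> space M \<Longrightarrow> c n (g \<omega>) = \<sigma> (c n \<omega>)"
      using cell_permuting_map[OF \<sigma>(1)] by blast
    have [measurable]: "g \<in> M \<rightarrow>\<^sub>M M" and distr_g: "distr M M g = M"
      using g(1) by (auto simp: mp_maps_def)
    have g_err: "prob {\<omega> \<in> space M. v (g \<omega>) \<noteq> y (c n (g \<omega>))} \<le> \<delta>"
    proof -
      have "prob {\<omega> \<in> space M. v \<omega> \<noteq> y (c n \<omega>)} = measure (distr M M g) {\<omega> \<in> space M. v \<omega> \<noteq> y (c n \<omega>)}"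
        by (simp add: distr_g)
      also have "\<dots> = prob (g -` {\<omega> \<in> space M. v \<omega> \<noteq> y (c n \<omega>)} \<inter> space M)"
        by (rule measure_distr) auto
      also have "g -` {\<omega> \<in> space M. v \<omega> \<noteq> y (c n \<omega>)} \<inter> space M = {\<omega> \<in> space M. v (g \<omega>) \<noteq> y (c n (g \<omega>))}"
        using measurable_space[of g M M] by auto
      finally show ?thesis using y(2) by simp
    qed
    have "w i j - \<epsilon> \<le> prob {\<omega> \<in> space M. u \<omega> = i \<and> v (g \<omega>) = j}" if ij: "i \<in> F" "j \<in> G" for i j
    proof -
      let ?J = "{k\<in>{..<N n}. x k = i \<and> y (\<sigma> k) = j}"
      have "w i j - \<delta> - 1 / N n \<le> (N n * max 0 (w i j - \<delta>) - 1) / N n"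
        using N_pos[of n] by (simp add: diff_divide_distrib)
      also have "\<dots> \<le> real (q i j) / N n" by (intro divide_right_mono q_ge) simp
      also have "\<dots> \<le> card ?J / N n" using \<sigma>(2)[OF ij] by (intro divide_right_mono) auto
      also have "\<dots> = prob {\<omega> \<in> space M. c n \<omega> \<in> ?J}" by (intro prob_cells[symmetric]) auto
      also have "\<dots> \<le> prob ({\<omega> \<in> space M. u \<omega> = i \<and> v (g \<omega>) = j} \<union>
          ({\<omega> \<in> space M. u \<omega> \<noteq> x (c n \<omega>)} \<union> {\<omega> \<in> space M. v (g \<omega>) \<noteq> y (c n (g \<omega>))}))"
        using g(2) by (intro finite_measure_mono) auto
      also have "\<dots> \<le> prob {\<omega> \<in> space M. u \<omega> = i \<and> v (g \<omega>) = j} +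
          prob ({\<omega> \<in> space M. u \<omega> \<noteq> x (c n \<omega>)} \<union> {\<omega> \<in> space M. v (g \<omega>) \<noteq> y (c n (g \<omega>))})"
        by (intro measure_Un_le) auto
      also have "prob ({\<omega> \<in> space M. u \<omega> \<noteq> x (c n \<omega>)} \<union> {\<omega> \<in> space M. v (g \<omega>) \<noteq> y (c n (g \<omega>))})
        \<le> prob {\<omega> \<in> space M. u \<omega> \<noteq> x (c n \<omega>)} + prob {\<omega> \<in> space M. v (g \<omega>) \<noteq> y (c n (g \<omega>))}"
        by (intro measure_Un_le) auto
      finally show ?thesis using x(2) g_err N_large unfolding \<delta>_def by linarith
    qed
    then show ?thesis using g(2) by (intro bexI[OF _ g(1)] conjI exI[of _ \<sigma>] ballI) simp_all
  qed
  then show ?thesis by blast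
qed

end

text \<open>Between families of equal total mass, a lower bound in each entry controls the deviation in both
  directions.\<close>

lemma sum_abs_diff_le:
  fixes a w :: "'l \<Rightarrow> real"
  assumes "\<And>l. l \<in> K \<Longrightarrow> w l - \<epsilon> \<le> a l" "sum a K = sum w K" "0 \<le> \<epsilon>"
  shows "(\<Sum>l\<in>K. \<bar>a l - w l\<bar>) \<le> 2 * real (card K) * \<epsilon>"
proof -
  have "(\<Sum>l\<in>K. \<bar>a l - w l\<bar>) \<le> (\<Sum>l\<in>K. (a l - w l) + 2 * \<epsilon>)"
  proof (rule sum_mono)
    fix l assume "l \<in> K"
    then show "\<bar>a l - w l\<bar> \<le> (a l - w l) + 2 * \<epsilon>" using assms(1)[of l] assms(3) by linarith
  qed
  also have "\<dots> = 2 * real (card K) * \<epsilon>" using assms(2) by (simp add: sum.distrib sum_subtractf)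
  finally show ?thesis .
qed

lemma borel_prob_measure_distr:
  assumes "prob_space M" "f \<in> borel_measurable M"
  shows "distr M borel f \<in> borel_prob_measures"
  using prob_space.prob_space_distr[OF assms] by (simp add: borel_prob_measures_def)

lemma sum_measure_label:
  assumes "finite_measure \<nu>" "finite F" "L \<in> \<nu> \<rightarrow>\<^sub>M count_space F" "A \<in> sets \<nu>"
  shows "(\<Sum>l\<in>F. measure \<nu> {y \<in> A. L y = l}) = measure \<nu> A"
proof -
  interpret finite_measure \<nu> by fact
  have "{y \<in> A. L y = l} \<in> sets \<nu>" if "l \<in> F" for l
  proof -
    have "L -` {l} \<inter> space \<nu> \<in> sets \<nu>" using that by (intro measurable_sets[OF assms(3)]) simp
    then have "A \<inter> (L -` {l} \<inter> space \<nu>) \<in> sets \<nu>" using assms(4) by (rule sets.Int[rotated])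
    also have "A \<inter> (L -` {l} \<inter> space \<nu>) = {y \<in> A. L y = l}" using sets.sets_into_space[OF assms(4)] by auto
    finally show ?thesis .
  qed
  then have "(\<Sum>l\<in>F. measure \<nu> {y \<in> A. L y = l}) = measure \<nu> (\<Union>l\<in>F. {y \<in> A. L y = l})"
    using assms(2) by (intro finite_measure_finite_Union[symmetric]) (auto simp: disjoint_family_on_def)
  also have "(\<Union>l\<in>F. {y \<in> A. L y = l}) = A"
    using measurable_space[OF assms(3)] sets.sets_into_space[OF assms(4)] by auto
  finally show ?thesis .
qed

context refining_partitions
begin

text \<open>The one-sided bound of \<open>coupling_lower_bound\<close>, applied to the label masses of \<open>\<mu>\<close>, becomes a bound on
  the total variation because both joint laws of labels are probabilities.\<close>

lemma coupling_label_approx: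
  fixes Z :: "'a \<Rightarrow> 'z::second_countable_topology" and Z' :: "'a \<Rightarrow> 'w::second_countable_topology"
  assumes Z[measurable]: "Z \<in> borel_measurable M" and Z'[measurable]: "Z' \<in> borel_measurable M"
    and \<mu>: "\<mu> \<in> couplings (distr M borel Z) (distr M borel Z')"
    and fin: "finite F" "finite G"
    and a[measurable]: "a \<in> borel \<rightarrow>\<^sub>M count_space F" and b[measurable]: "b \<in> borel \<rightarrow>\<^sub>M count_space G"
    and "0 < \<epsilon>"
  shows "\<exists>n0. \<forall>n\<ge>n0. \<exists>g\<in>mp_maps M. (\<exists>\<sigma>. \<forall>\<omega>\<in>space M. c n (g \<omega>) = \<sigma> (c n \<omega>)) \<and>
    (\<Sum>l\<in>F \<times> G. \<bar>measure (distr M borel (\<lambda>\<omega>. (Z \<omega>, Z' (g \<omega>)))) {z. (a (fst z), b (snd z)) = l}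
       - measure \<mu> {z. (a (fst z), b (snd z)) = l}\<bar>) \<le> \<epsilon>"
proof -
  have \<mu>_prob: "\<mu> \<in> borel_prob_measures" and fst_\<mu>: "distr \<mu> borel fst = distr M borel Z"
    and snd_\<mu>: "distr \<mu> borel snd = distr M borel Z'"
    using \<mu> by (auto simp: couplings_def)
  interpret \<mu>: prob_space \<mu> using \<mu>_prob by (simp add: borel_prob_measures_def)
  have sets_\<mu>: "sets \<mu> = sets borel" using \<mu>_prob by (simp add: borel_prob_measures_def)
  then have [measurable_cong]: "sets \<mu> = sets (borel \<Otimes>\<^sub>M borel)" unfolding borel_prod .
  have space_\<mu>: "space \<mu> = UNIV" using sets_eq_imp_space_eq[OF sets_\<mu>] by simp
  define lab where "lab = (\<lambda>z. (a (fst z), b (snd z)))"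
  have lab: "lab \<in> borel \<rightarrow>\<^sub>M count_space (F \<times> G)"
  proof -
    have "lab \<in> (borel \<Otimes>\<^sub>M borel) \<rightarrow>\<^sub>M (count_space F \<Otimes>\<^sub>M count_space G)"
      unfolding lab_def by measurable
    then show ?thesis
      unfolding borel_prod using fin by (simp add: pair_measure_countable countable_finite)
  qed
  have sets_a: "{z. a z = i} \<in> sets borel" for i
    using pred_label_eq[OF a, of i] by (simp add: pred_def)
  have sets_b: "{z. b z = j} \<in> sets borel" for j
    using pred_label_eq[OF b, of j] by (simp add: pred_def)
  define w where "w = (\<lambda>i j. measure \<mu> {z. lab z = (i, j)})"
  have row: "(\<Sum>j\<in>G. w i j) = prob {\<omega> \<in> space M. a (Z \<omega>) = i}" for i
  proof -
    have s: "fst -` {z. a z = i} \<inter> space \<mu> \<in> sets \<mu>"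
      by (rule measurable_sets[OF _ sets_a]) measurable
    have m: "(\<lambda>z. b (snd z)) \<in> \<mu> \<rightarrow>\<^sub>M count_space G" by measurable
    have "(\<Sum>j\<in>G. w i j) = (\<Sum>j\<in>G. measure \<mu> {y \<in> fst -` {z. a z = i} \<inter> space \<mu>. b (snd y) = j})"
      by (simp add: w_def lab_def space_\<mu>)
    also have "\<dots> = measure \<mu> (fst -` {z. a z = i} \<inter> space \<mu>)"
      by (rule sum_measure_label[OF \<mu>.finite_measure_axioms fin(2) m s])
    also have "\<dots> = measure (distr \<mu> borel fst) {z. a z = i}"
      by (rule measure_distr[symmetric]) (auto simp: sets_a)
    also have "\<dots> = prob (Z -` {z. a z = i} \<inter> space M)"
      unfolding fst_\<mu> by (rule measure_distr) (auto simp: sets_a)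
    also have "Z -` {z. a z = i} \<inter> space M = {\<omega> \<in> space M. a (Z \<omega>) = i}" by auto
    finally show ?thesis .
  qed
  have col: "(\<Sum>i\<in>F. w i j) = prob {\<omega> \<in> space M. b (Z' \<omega>) = j}" for j
  proof -
    have s: "snd -` {z. b z = j} \<inter> space \<mu> \<in> sets \<mu>"
      by (rule measurable_sets[OF _ sets_b]) measurable
    have m: "(\<lambda>z. a (fst z)) \<in> \<mu> \<rightarrow>\<^sub>M count_space F" by measurable
    have "(\<Sum>i\<in>F. w i j) = (\<Sum>i\<in>F. measure \<mu> {y \<in> snd -` {z. b z = j} \<inter> space \<mu>. a (fst y) = i})"
      by (simp add: w_def lab_def space_\<mu> conj_commute)
    also have "\<dots> = measure \<mu> (snd -` {z. b z = j} \<inter> space \<mu>)"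
      by (rule sum_measure_label[OF \<mu>.finite_measure_axioms fin(1) m s])
    also have "\<dots> = measure (distr \<mu> borel snd) {z. b z = j}"
      by (rule measure_distr[symmetric]) (auto simp: sets_b)
    also have "\<dots> = prob (Z' -` {z. b z = j} \<inter> space M)"
      unfolding snd_\<mu> by (rule measure_distr) (auto simp: sets_b)
    also have "Z' -` {z. b z = j} \<inter> space M = {\<omega> \<in> space M. b (Z' \<omega>) = j}" by auto
    finally show ?thesis .
  qed
  define \<delta> where "\<delta> = \<epsilon> / (2 * (real (card (F \<times> G)) + 1))"
  have \<delta>: "0 < \<delta>" "2 * real (card (F \<times> G)) * \<delta> \<le> \<epsilon>"
    using \<open>0 < \<epsilon>\<close> by (auto simp: \<delta>_def field_simps)
  have "\<exists>n0. \<forall>n\<ge>n0. \<exists>g\<in>mp_maps M. (\<exists>\<sigma>. \<forall>\<omega>\<in>space M. c n (g \<omega>) = \<sigma> (c n \<omega>)) \<and>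
    (\<forall>i\<in>F. \<forall>j\<in>G. w i j - \<delta> \<le> prob {\<omega> \<in> space M. a (Z \<omega>) = i \<and> b (Z' (g \<omega>)) = j})"
  proof (rule coupling_lower_bound[OF fin, of "\<lambda>\<omega>. a (Z \<omega>)" "\<lambda>\<omega>. b (Z' \<omega>)"])
    show "(\<lambda>\<omega>. a (Z \<omega>)) \<in> M \<rightarrow>\<^sub>M count_space F" "(\<lambda>\<omega>. b (Z' \<omega>)) \<in> M \<rightarrow>\<^sub>M count_space G"
      by measurable
    show "0 \<le> w i j" for i j by (simp add: w_def)
  qed (simp_all only: row col \<delta>)
  then obtain n0 where n0: "\<forall>n\<ge>n0. \<exists>g\<in>mp_maps M. (\<exists>\<sigma>. \<forall>\<omega>\<in>space M. c n (g \<omega>) = \<sigma> (c n \<omega>)) \<and>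
    (\<forall>i\<in>F. \<forall>j\<in>G. w i j - \<delta> \<le> prob {\<omega> \<in> space M. a (Z \<omega>) = i \<and> b (Z' (g \<omega>)) = j})" ..
  have bound: "(\<Sum>l\<in>F \<times> G. \<bar>measure (distr M borel (\<lambda>\<omega>. (Z \<omega>, Z' (g \<omega>)))) {z. lab z = l}
       - measure \<mu> {z. lab z = l}\<bar>) \<le> \<epsilon>"
    if g: "g \<in> mp_maps M"
      "\<forall>i\<in>F. \<forall>j\<in>G. w i j - \<delta> \<le> prob {\<omega> \<in> space M. a (Z \<omega>) = i \<and> b (Z' (g \<omega>)) = j}" for g
  proof -
    have [measurable]: "g \<in> M \<rightarrow>\<^sub>M M" using g(1) by (simp add: mp_maps_def)
    define \<nu> where "\<nu> = distr M borel (\<lambda>\<omega>. (Z \<omega>, Z' (g \<omega>)))"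
    have meas: "(\<lambda>\<omega>. (Z \<omega>, Z' (g \<omega>))) \<in> borel_measurable M" by measurable
    interpret \<nu>: prob_space \<nu> unfolding \<nu>_def by (rule prob_space_distr[OF meas])
    have \<nu>_lab: "measure \<nu> {z. lab z = (i, j)} = prob {\<omega> \<in> space M. a (Z \<omega>) = i \<and> b (Z' (g \<omega>)) = j}" for i j
    proof -
      have "{z. lab z = (i, j)} \<in> sets borel" using pred_label_eq[OF lab] by (simp add: pred_def)
      then have "measure \<nu> {z. lab z = (i, j)} = prob ((\<lambda>\<omega>. (Z \<omega>, Z' (g \<omega>))) -` {z. lab z = (i, j)} \<inter> space M)"
        unfolding \<nu>_def by (rule measure_distr[OF meas])
      also have "(\<lambda>\<omega>. (Z \<omega>, Z' (g \<omega>))) -` {z. lab z = (i, j)} \<inter> space M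
        = {\<omega> \<in> space M. a (Z \<omega>) = i \<and> b (Z' (g \<omega>)) = j}" by (auto simp: lab_def)
      finally show ?thesis .
    qed
    have total: "(\<Sum>l\<in>F \<times> G. measure \<rho> {z. lab z = l}) = 1"
      if "prob_space \<rho>" "sets \<rho> = sets borel" for \<rho>
    proof -
      interpret \<rho>: prob_space \<rho> by fact
      have sp: "space \<rho> = UNIV" using sets_eq_imp_space_eq[OF that(2)] by simp
      have "lab \<in> \<rho> \<rightarrow>\<^sub>M count_space (F \<times> G)" using lab by (simp add: measurable_cong_sets[OF that(2) refl])
      then have "(\<Sum>l\<in>F \<times> G. measure \<rho> {z \<in> space \<rho>. lab z = l}) = measure \<rho> (space \<rho>)"
        using fin by (intro sum_measure_label \<rho>.finite_measure_axioms) auto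
      then show ?thesis by (simp add: sp \<rho>.prob_space[unfolded sp])
    qed
    have "(\<Sum>l\<in>F \<times> G. \<bar>measure \<nu> {z. lab z = l} - measure \<mu> {z. lab z = l}\<bar>) \<le> 2 * real (card (F \<times> G)) * \<delta>"
    proof (rule sum_abs_diff_le)
      fix l assume "l \<in> F \<times> G"
      then obtain i j where l: "l = (i, j)" "i \<in> F" "j \<in> G" by blast
      have "w i j - \<delta> \<le> prob {\<omega> \<in> space M. a (Z \<omega>) = i \<and> b (Z' (g \<omega>)) = j}"
        using g(2) l(2,3) by blast
      then show "measure \<mu> {z. lab z = l} - \<delta> \<le> measure \<nu> {z. lab z = l}"
        unfolding l(1) \<nu>_lab by (simp add: w_def)
    next
      show "(\<Sum>l\<in>F \<times> G. measure \<nu> {z. lab z = l}) = (\<Sum>l\<in>F \<times> G. measure \<mu> {z. lab z = l})"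
        using total[OF \<nu>.prob_space_axioms] total[OF \<mu>.prob_space_axioms sets_\<mu>] by (simp add: \<nu>_def)
    qed (use \<delta> in simp)
    then show ?thesis using \<delta>(2) unfolding \<nu>_def by linarith
  qed
  show ?thesis
  proof (intro exI[of _ n0] allI impI)
    fix n assume n: "n0 \<le> n"
    obtain g where g: "g \<in> mp_maps M" "\<exists>\<sigma>. \<forall>\<omega>\<in>space M. c n (g \<omega>) = \<sigma> (c n \<omega>)"
      "\<forall>i\<in>F. \<forall>j\<in>G. w i j - \<delta> \<le> prob {\<omega> \<in> space M. a (Z \<omega>) = i \<and> b (Z' (g \<omega>)) = j}"
      using n0[THEN spec, THEN mp, OF n] by (elim bexE conjE)
    show "\<exists>g\<in>mp_maps M. (\<exists>\<sigma>. \<forall>\<omega>\<in>space M. c n (g \<omega>) = \<sigma> (c n \<omega>)) \<and>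
      (\<Sum>l\<in>F \<times> G. \<bar>measure (distr M borel (\<lambda>\<omega>. (Z \<omega>, Z' (g \<omega>)))) {z. (a (fst z), b (snd z)) = l}
         - measure \<mu> {z. (a (fst z), b (snd z)) = l}\<bar>) \<le> \<epsilon>"
      using bound[OF g(1,3)] unfolding lab_def by (intro bexI[OF _ g(1)] conjI g(2))
  qed
qed

end

section \<open>Narrow convergence from convergence of labels\<close>

lemma integral_label:
  assumes "\<nu> \<in> borel_prob_measures" "finite F" and L: "L \<in> borel \<rightarrow>\<^sub>M count_space F"
  shows "(\<lambda>x. h (L x) :: real) \<in> borel_measurable borel"
    and "(\<integral>x. h (L x) \<partial>\<nu>) = (\<Sum>l\<in>F. h l * measure \<nu> {y. L y = l})"
proof -
  interpret prob_space \<nu> using assms(1) by (simp add: borel_prob_measures_def)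
  have sets_\<nu>: "sets \<nu> = sets borel" using assms(1) by (simp add: borel_prob_measures_def)
  have L_F: "L x \<in> F" for x using measurable_space[OF L] by simp
  have lev: "{y. L y = l} \<in> sets borel" if "l \<in> F" for l
    using measurable_sets[OF L, of "{l}"] that by (simp add: vimage_def)
  have eq: "h (L x) = (\<Sum>l\<in>F. h l * indicator {y. L y = l} x)" for x
    using assms(2) L_F[of x] by (simp add: indicator_def if_distrib sum.delta cong: if_cong)
  show "(\<lambda>x. h (L x) :: real) \<in> borel_measurable borel"
    unfolding eq using lev by (intro borel_measurable_sum borel_measurable_times borel_measurable_indicator) auto
  have "(\<integral>x. h (L x) \<partial>\<nu>) = (\<Sum>l\<in>F. \<integral>x. h l * indicator {y. L y = l} x \<partial>\<nu>)"
    unfolding eq using lev sets_\<nu>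
    by (intro Bochner_Integration.integral_sum integrable_mult_right integrable_real_indicator)
       (auto simp: emeasure_eq_measure)
  also have "\<dots> = (\<Sum>l\<in>F. h l * measure \<nu> {y. L y = l})"
    using lev sets_\<nu> by (intro sum.cong) (auto simp: sets_eq_imp_space_eq[OF sets_\<nu>])
  finally show "(\<integral>x. h (L x) \<partial>\<nu>) = (\<Sum>l\<in>F. h l * measure \<nu> {y. L y = l})" .
qed

text \<open>Replace a bounded continuous \<open>f\<close> by its infimum over each label class. These functions lie below
  \<open>f\<close>, have finitely many values, and converge pointwise to \<open>f\<close> by continuity, because the label classes
  shrink to points. Their integrals against \<open>\<mu>s n\<close> and \<open>\<mu>\<close> differ by at most the sup norm times
  the variation distance of the labels. This bounds the integrals of \<open>f\<close> from below by a sequence with the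
  right limit; applied to \<open>-f\<close>, it also bounds them from above.\<close>

lemma narrowly_converges_if_labels_converge:
  fixes \<mu>s :: "nat \<Rightarrow> 'x::topological_space measure" and L :: "nat \<Rightarrow> 'x \<Rightarrow> 'l"
  assumes \<mu>s: "\<And>n. \<mu>s n \<in> borel_prob_measures" and \<mu>: "\<mu> \<in> borel_prob_measures"
    and fin: "\<And>n. finite (F n)" and L: "\<And>n. L n \<in> borel \<rightarrow>\<^sub>M count_space (F n)"
    and refine: "\<And>x U. open U \<Longrightarrow> x \<in> U \<Longrightarrow> \<exists>m. \<forall>n\<ge>m. \<forall>y. L n y = L n x \<longrightarrow> y \<in> U"
    and tv: "(\<lambda>n. \<Sum>l\<in>F n. \<bar>measure (\<mu>s n) {y. L n y = l} - measure \<mu> {y. L n y = l}\<bar>) \<longlonglongrightarrow> 0"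
  shows "narrowly_converges \<mu>s \<mu>"
proof -
  have L_F: "L n x \<in> F n" for n x using measurable_space[OF L] by simp
  have lower: "\<exists>l. l \<longlonglongrightarrow> (\<integral>x. f x \<partial>\<mu>) \<and> (\<forall>n. l n \<le> (\<integral>x. f x \<partial>\<mu>s n))"
    if f: "continuous_on UNIV f" "\<And>x. \<bar>f x\<bar> \<le> B" for f :: "'x \<Rightarrow> real" and B
  proof -
    define h where "h = (\<lambda>n l. INF y\<in>{y. L n y = l}. f y)"
    have bdd: "bdd_below (f ` A)" for A
      using f(2) by (intro bdd_belowI[of _ "-B"]) (auto simp: abs_le_iff minus_le_iff)
    have h_le: "h n (L n x) \<le> f x" for n x
      unfolding h_def by (rule cINF_lower[OF bdd]) simp
    have le_h: "r \<le> h n (L n x)" if "\<And>y. L n y = L n x \<Longrightarrow> r \<le> f y" for r n x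
      unfolding h_def using that by (intro cINF_greatest) auto
    have h_abs: "\<bar>h n (L n x)\<bar> \<le> B" for n x
    proof -
      have "-B \<le> h n (L n x)" using f(2) by (intro le_h) (auto simp: abs_le_iff minus_le_iff)
      then show ?thesis using h_le[of n x] f(2)[of x] by linarith
    qed
    have B: "0 \<le> B" using f(2)[of undefined] by linarith
    have int_\<mu>: "integrable \<nu> (\<lambda>x. h n (L n x))" "integrable \<nu> f"
      if \<nu>: "\<nu> \<in> borel_prob_measures" for \<nu> n
    proof -
      interpret prob_space \<nu> using \<nu> by (simp add: borel_prob_measures_def)
      have [measurable_cong]: "sets \<nu> = sets borel" using \<nu> by (simp add: borel_prob_measures_def)
      have [measurable]: "(\<lambda>x. h n (L n x)) \<in> borel_measurable borel"
        by (rule integral_label(1)[OF \<nu> fin L])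
      have [measurable]: "f \<in> borel_measurable borel"
        by (rule borel_measurable_continuous_onI[OF f(1)])
      show "integrable \<nu> (\<lambda>x. h n (L n x))"
        by (rule integrable_const_bound[of _ B]) (auto simp: h_abs)
      show "integrable \<nu> f"
        by (rule integrable_const_bound[of _ B]) (auto simp: f(2))
    qed
    define tvn where "tvn = (\<lambda>n. \<Sum>l\<in>F n. \<bar>measure (\<mu>s n) {y. L n y = l} - measure \<mu> {y. L n y = l}\<bar>)"
    define l where "l = (\<lambda>n. (\<integral>x. h n (L n x) \<partial>\<mu>) - B * tvn n)"
    have "l n \<le> (\<integral>x. f x \<partial>\<mu>s n)" for n
    proof -
      have "(\<integral>x. h n (L n x) \<partial>\<mu>) - (\<integral>x. h n (L n x) \<partial>\<mu>s n)
        = (\<Sum>l\<in>F n. h n l * (measure \<mu> {y. L n y = l} - measure (\<mu>s n) {y. L n y = l}))"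
        by (simp add: integral_label(2)[OF \<mu> fin L] integral_label(2)[OF \<mu>s fin L]
            sum_subtractf right_diff_distrib)
      also have "\<dots> \<le> (\<Sum>l\<in>F n. B * \<bar>measure (\<mu>s n) {y. L n y = l} - measure \<mu> {y. L n y = l}\<bar>)"
      proof (rule sum_mono)
        fix l
        show "h n l * (measure \<mu> {y. L n y = l} - measure (\<mu>s n) {y. L n y = l})
          \<le> B * \<bar>measure (\<mu>s n) {y. L n y = l} - measure \<mu> {y. L n y = l}\<bar>"
        proof (cases "\<exists>y. L n y = l")
          case True
          then have "\<bar>h n l\<bar> \<le> B" using h_abs by blast
          then have "\<bar>h n l * (measure \<mu> {y. L n y = l} - measure (\<mu>s n) {y. L n y = l})\<bar>
            \<le> B * \<bar>measure (\<mu>s n) {y. L n y = l} - measure \<mu> {y. L n y = l}\<bar>"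
            unfolding abs_mult abs_minus_commute[of "measure \<mu> _"] by (rule mult_right_mono) simp
          then show ?thesis by linarith
        next
          case False
          then have "{y. L n y = l} = {}" by blast
          then show ?thesis by (simp only: measure_empty) simp
        qed
      qed
      also have "\<dots> = B * tvn n" by (simp add: tvn_def sum_distrib_left)
      finally have "l n \<le> (\<integral>x. h n (L n x) \<partial>\<mu>s n)" by (simp add: l_def)
      also have "\<dots> \<le> (\<integral>x. f x \<partial>\<mu>s n)"
        by (intro integral_mono int_\<mu> \<mu>s h_le)
      finally show ?thesis .
    qed
    moreover have "l \<longlonglongrightarrow> (\<integral>x. f x \<partial>\<mu>) - B * 0"
      unfolding l_def
    proof (intro tendsto_diff tendsto_mult tendsto_const)
      show "tvn \<longlonglongrightarrow> 0" unfolding tvn_def by (rule tv)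
      show "(\<lambda>n. \<integral>x. h n (L n x) \<partial>\<mu>) \<longlonglongrightarrow> (\<integral>x. f x \<partial>\<mu>)"
      proof (rule integral_dominated_convergence[where w="\<lambda>_. B"])
        show "f \<in> borel_measurable \<mu>" using int_\<mu>(2)[OF \<mu>] by simp
        show "(\<lambda>x. h n (L n x)) \<in> borel_measurable \<mu>" for n using int_\<mu>(1)[OF \<mu>] by simp
        interpret prob_space \<mu> using \<mu> by (simp add: borel_prob_measures_def)
        show "integrable \<mu> (\<lambda>_. B)" by simp
        show "AE x in \<mu>. norm (h n (L n x)) \<le> B" for n using h_abs by simp
        have "(\<lambda>n. h n (L n x)) \<longlonglongrightarrow> f x" for x
        proof (rule LIMSEQ_I)
          fix r :: real assume "0 < r"
          have "open (f -` {f x - r / 2<..})"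
            using f(1) by (intro open_vimage) auto
          moreover have "x \<in> f -` {f x - r / 2<..}" using \<open>0 < r\<close> by simp
          ultimately obtain m where m: "\<forall>n\<ge>m. \<forall>y. L n y = L n x \<longrightarrow> y \<in> f -` {f x - r / 2<..}"
            using refine by meson
          have "norm (h n (L n x) - f x) < r" if "n \<ge> m" for n
          proof -
            have "f x - r / 2 \<le> h n (L n x)" using m that by (intro le_h) force
            then show ?thesis using h_le[of n x] \<open>0 < r\<close> by (simp add: abs_if)
          qed
          then show "\<exists>no. \<forall>n\<ge>no. norm (h n (L n x) - f x) < r" by blast
        qed
        then show "AE x in \<mu>. (\<lambda>n. h n (L n x)) \<longlonglongrightarrow> f x" by simp
      qed
    qed
    ultimately show ?thesis by (intro exI[of _ l]) simp
  qed
  have "(\<lambda>n. \<integral>x. f x \<partial>\<mu>s n) \<longlonglongrightarrow> (\<integral>x. f x \<partial>\<mu>)"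
    if f: "continuous_on UNIV f" "bounded (range f)" for f :: "'x \<Rightarrow> real"
  proof -
    obtain B where B: "\<And>x. \<bar>f x\<bar> \<le> B"
      using f(2) unfolding bounded_iff by auto
    obtain l where l: "l \<longlonglongrightarrow> (\<integral>x. f x \<partial>\<mu>)" "\<And>n. l n \<le> (\<integral>x. f x \<partial>\<mu>s n)"
      using lower[OF f(1) B] by blast
    obtain u where u: "u \<longlonglongrightarrow> (\<integral>x. - f x \<partial>\<mu>)" "\<And>n. u n \<le> (\<integral>x. - f x \<partial>\<mu>s n)"
      using lower[of "\<lambda>x. - f x" B] f(1) B by (auto intro: continuous_on_minus)
    show ?thesis
    proof (rule tendsto_sandwich[OF _ _ l(1)])
      show "(\<lambda>n. - u n) \<longlonglongrightarrow> (\<integral>x. f x \<partial>\<mu>)" using tendsto_minus[OF u(1)] by simp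
      have "(\<integral>x. f x \<partial>\<mu>s n) \<le> - u n" for n using u(2)[of n] by simp
      then show "\<forall>\<^sub>F n in sequentially. (\<integral>x. f x \<partial>\<mu>s n) \<le> - u n" by simp
    qed (use l(2) in simp)
  qed
  then show ?thesis using \<mu>s \<mu> by (simp add: narrowly_converges_def)
qed

text \<open>The label of a point records which of the first \<open>n\<close> sets of a countable base contain it.\<close>

lemma basis_labels:
  obtains a :: "nat \<Rightarrow> 'z::second_countable_topology \<Rightarrow> nat set" where
    "\<And>n. a n \<in> borel \<rightarrow>\<^sub>M count_space (Pow {..<n})"
    "\<And>x U. open U \<Longrightarrow> x \<in> U \<Longrightarrow> \<exists>m. \<forall>n\<ge>m. \<forall>y. a n y = a n x \<longrightarrow> y \<in> U"
proof -
  obtain \<B> :: "'z set set" where \<B>: "countable \<B>" "topological_basis \<B>"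
    using ex_countable_basis by blast
  have "\<B> \<noteq> {}" using topological_basisE[OF \<B>(2) open_UNIV] by blast
  define V where "V = from_nat_into \<B>"
  have V_open: "open (V i)" for i
    using from_nat_into[OF \<open>\<B> \<noteq> {}\<close>] topological_basis_open[OF \<B>(2)] by (simp add: V_def)
  define a where "a = (\<lambda>n x. {i. i < n \<and> x \<in> V i})"
  show thesis
  proof (rule that[of a])
    fix n
    show "a n \<in> borel \<rightarrow>\<^sub>M count_space (Pow {..<n})"
    proof (subst measurable_count_space_eq2, simp, intro conjI ballI)
      show "a n \<in> space borel \<rightarrow> Pow {..<n}" by (auto simp: a_def)
      fix s :: "nat set"
      have "a n -` {s} \<inter> space borel = {x. \<forall>i. (i < n \<and> x \<in> V i) = (i \<in> s)}"
        by (auto simp: a_def)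
      also have "\<dots> \<in> sets borel"
      proof -
        have [measurable]: "V i \<in> sets borel" for i using V_open by simp
        show ?thesis by measurable
      qed
      finally show "a n -` {s} \<inter> space borel \<in> sets borel" .
    qed
  next
    fix x :: 'z and U assume "open U" "x \<in> U"
    then obtain W where W: "W \<in> \<B>" "x \<in> W" "W \<subseteq> U" using topological_basisE[OF \<B>(2)] by metis
    obtain i where i: "V i = W" using from_nat_into_surj[OF \<B>(1) W(1)] by (auto simp: V_def)
    have "y \<in> U" if "n \<ge> Suc i" "a n y = a n x" for n y
    proof -
      have "i \<in> a n x" using that(1) i W(2) by (simp add: a_def)
      then have "i \<in> a n y" using that(2) by simp
      then show ?thesis using i W(3) by (auto simp: a_def)
    qed
    then show "\<exists>m. \<forall>n\<ge>m. \<forall>y. a n y = a n x \<longrightarrow> y \<in> U" by blast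
  qed
qed

context refining_partitions
begin

text \<open>A diagonal choice: at step \<open>m\<close> the labels of rank \<open>m\<close> are matched up to \<open>1 / (m + 1)\<close>, on a level
  \<open>k m\<close> beyond the threshold required for this.\<close>

lemma coupling_approximation:
  fixes Z :: "'a \<Rightarrow> 'z::second_countable_topology" and Z' :: "'a \<Rightarrow> 'w::second_countable_topology"
  assumes Z[measurable]: "Z \<in> borel_measurable M" and Z'[measurable]: "Z' \<in> borel_measurable M"
    and \<mu>: "\<mu> \<in> couplings (distr M borel Z) (distr M borel Z')"
  obtains k g where "strict_mono (k :: nat \<Rightarrow> nat)" "\<And>n. g n \<in> mp_maps M"
    "\<And>n. \<exists>\<sigma>. \<forall>\<omega>\<in>space M. c (k n) (g n \<omega>) = \<sigma> (c (k n) \<omega>)"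
    "narrowly_converges (\<lambda>n. distr M borel (\<lambda>\<omega>. (Z \<omega>, Z' (g n \<omega>)))) \<mu>"
proof -
  obtain a :: "nat \<Rightarrow> 'z \<Rightarrow> nat set" where a: "\<And>n. a n \<in> borel \<rightarrow>\<^sub>M count_space (Pow {..<n})"
    "\<And>x U. open U \<Longrightarrow> x \<in> U \<Longrightarrow> \<exists>m. \<forall>n\<ge>m. \<forall>y. a n y = a n x \<longrightarrow> y \<in> U"
    using basis_labels by metis
  obtain b :: "nat \<Rightarrow> 'w \<Rightarrow> nat set" where b: "\<And>n. b n \<in> borel \<rightarrow>\<^sub>M count_space (Pow {..<n})"
    "\<And>x U. open U \<Longrightarrow> x \<in> U \<Longrightarrow> \<exists>m. \<forall>n\<ge>m. \<forall>y. b n y = b n x \<longrightarrow> y \<in> U"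
    using basis_labels by metis
  define F :: "nat \<Rightarrow> (nat set \<times> nat set) set" where "F = (\<lambda>m. Pow {..<m} \<times> Pow {..<m})"
  define L where "L = (\<lambda>m z. (a m (fst z), b m (snd z)))"
  define err where "err = (\<lambda>m g. \<Sum>l\<in>F m. \<bar>measure (distr M borel (\<lambda>\<omega>. (Z \<omega>, Z' (g \<omega>)))) {z. L m z = l}
       - measure \<mu> {z. L m z = l}\<bar>)"
  have "\<exists>n0. \<forall>m. \<forall>n\<ge>n0 m. \<exists>g\<in>mp_maps M. (\<exists>\<sigma>. \<forall>\<omega>\<in>space M. c n (g \<omega>) = \<sigma> (c n \<omega>)) \<and>
      err m g \<le> 1 / Suc m"
    unfolding err_def F_def L_def
    by (intro choice allI coupling_label_approx[OF Z Z' \<mu>] a b) auto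
  then obtain n0 where n0: "\<forall>m. \<forall>n\<ge>n0 m. \<exists>g\<in>mp_maps M.
      (\<exists>\<sigma>. \<forall>\<omega>\<in>space M. c n (g \<omega>) = \<sigma> (c n \<omega>)) \<and> err m g \<le> 1 / Suc m" ..
  define k where "k = (\<lambda>m. \<Sum>i\<le>m. Suc (n0 i))"
  have "strict_mono k" by (simp add: strict_mono_Suc_iff k_def)
  have "n0 m \<le> k m" for m
  proof -
    have "Suc (n0 m) \<le> k m" unfolding k_def by (rule member_le_sum) auto
    then show ?thesis by simp
  qed
  then have "\<forall>m. \<exists>g. g \<in> mp_maps M \<and> (\<exists>\<sigma>. \<forall>\<omega>\<in>space M. c (k m) (g \<omega>) = \<sigma> (c (k m) \<omega>)) \<and> err m g \<le> 1 / Suc m"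
    using n0 by (simp only: Bex_def simp_thms)
  then obtain g where g: "\<forall>m. g m \<in> mp_maps M \<and> (\<exists>\<sigma>. \<forall>\<omega>\<in>space M. c (k m) (g m \<omega>) = \<sigma> (c (k m) \<omega>)) \<and> err m (g m) \<le> 1 / Suc m"
    by (rule choice[THEN exE])
  have g_meas[measurable]: "g m \<in> M \<rightarrow>\<^sub>M M" for m using g by (simp add: mp_maps_def)
  have "narrowly_converges (\<lambda>n. distr M borel (\<lambda>\<omega>. (Z \<omega>, Z' (g n \<omega>)))) \<mu>"
  proof (rule narrowly_converges_if_labels_converge[where F=F and L=L])
    show "distr M borel (\<lambda>\<omega>. (Z \<omega>, Z' (g n \<omega>))) \<in> borel_prob_measures" for n
      by (intro borel_prob_measure_distr prob_space_axioms) measurable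
    show "\<mu> \<in> borel_prob_measures" using \<mu> by (simp add: couplings_def)
    show "finite (F n)" for n by (simp add: F_def)
    show "L n \<in> borel \<rightarrow>\<^sub>M count_space (F n)" for n
    proof -
      note [measurable] = a(1) b(1)
      have "L n \<in> (borel \<Otimes>\<^sub>M borel) \<rightarrow>\<^sub>M (count_space (Pow {..<n}) \<Otimes>\<^sub>M count_space (Pow {..<n}))"
        unfolding L_def by measurable
      then show ?thesis
        unfolding borel_prod by (simp add: pair_measure_countable countable_finite F_def)
    qed
    show "\<exists>m. \<forall>n\<ge>m. \<forall>y. L n y = L n x \<longrightarrow> y \<in> U" if U: "open U" "x \<in> U" for x U
    proof -
      obtain A B where AB: "open A" "open B" "x \<in> A \<times> B" "A \<times> B \<subseteq> U"
        using open_prod_elim[OF U] by blast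
      obtain m1 where m1: "\<forall>n\<ge>m1. \<forall>y. a n y = a n (fst x) \<longrightarrow> y \<in> A"
        using a(2)[OF AB(1), of "fst x"] AB(3) by auto
      obtain m2 where m2: "\<forall>n\<ge>m2. \<forall>y. b n y = b n (snd x) \<longrightarrow> y \<in> B"
        using b(2)[OF AB(2), of "snd x"] AB(3) by auto
      have "y \<in> U" if "n \<ge> max m1 m2" "L n y = L n x" for n y
        using m1[rule_format, of n "fst y"] m2[rule_format, of n "snd y"] that AB(4)
        by (auto simp: L_def mem_Times_iff)
      then show ?thesis by blast
    qed
    show "(\<lambda>n. \<Sum>l\<in>F n. \<bar>measure (distr M borel (\<lambda>\<omega>. (Z \<omega>, Z' (g n \<omega>)))) {z. L n z = l}
       - measure \<mu> {z. L n z = l}\<bar>) \<longlonglongrightarrow> 0"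
    proof (rule tendsto_sandwich[OF _ _ tendsto_const LIMSEQ_inverse_real_of_nat])
      show "\<forall>\<^sub>F n in sequentially. (\<Sum>l\<in>F n. \<bar>measure (distr M borel (\<lambda>\<omega>. (Z \<omega>, Z' (g n \<omega>)))) {z. L n z = l}
         - measure \<mu> {z. L n z = l}\<bar>) \<le> inverse (real (Suc n))"
        using g by (simp add: err_def inverse_eq_divide)
    qed (simp add: sum_nonneg)
  qed
  then show thesis using that[of k g] \<open>strict_mono k\<close> g by simp
qed

end

section \<open>From narrow convergence to the diagonal to convergence in norm\<close>

lemma norm_diff_powr_le:
  fixes x y :: "'b::real_normed_vector"
  assumes "0 \<le> p"
  shows "norm (x - y) powr p \<le> 2 powr p * (norm x powr p + norm y powr p)"
proof -
  have "norm (x - y) \<le> 2 * max (norm x) (norm y)"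
    using norm_triangle_ineq4[of x y] by linarith
  then have "norm (x - y) powr p \<le> (2 * max (norm x) (norm y)) powr p"
    using assms by (intro powr_mono2) auto
  also have "\<dots> = 2 powr p * max (norm x) (norm y) powr p" by (simp add: powr_mult)
  also have "max (norm x) (norm y) powr p \<le> norm x powr p + norm y powr p"
    by (cases "norm x \<le> norm y") (auto simp: max_def)
  finally show ?thesis by simp
qed

lemma mp_maps_measurable: "g \<in> mp_maps M \<Longrightarrow> g \<in> M \<rightarrow>\<^sub>M M"
  by (simp add: mp_maps_def)

text \<open>The function \<open>H\<close>, which is \<open>2\<^sup>p (\<parallel>x\<parallel>\<^sup>p + \<parallel>y\<parallel>\<^sup>p) - \<parallel>y - x\<parallel>\<^sup>p\<close> with \<open>x\<close> and \<open>y\<close> the values of \<open>\<pi>\<close>, is continuous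
  and nonnegative, so narrow convergence gives a Fatou inequality for it after truncation at level \<open>R\<close>.
  The first summand has the same integral for all the measures involved, since the marginals do not
  change; the inequality thus says that the integral of \<open>\<parallel>y - x\<parallel>\<^sup>p\<close> has upper limit at most its value on
  the diagonal, which is zero.\<close>

lemma Lp_converges_of_narrow:
  fixes Z Z' :: "'a \<Rightarrow> 's::second_countable_topology"
    and \<pi> :: "'s \<Rightarrow> 'b::{banach, second_countable_topology}"
  assumes "prob_space M"
    and Z[measurable]: "Z \<in> borel_measurable M" and Z'[measurable]: "Z' \<in> borel_measurable M"
    and law: "distr M borel Z = distr M borel Z'"
    and g: "\<And>n. g n \<in> mp_maps M"
    and conv: "narrowly_converges (\<lambda>n. distr M borel (\<lambda>\<omega>. (Z \<omega>, Z' (g n \<omega>)))) (distr M borel (\<lambda>\<omega>. (Z \<omega>, Z \<omega>)))"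
    and "0 < p" and \<pi>: "continuous_on UNIV \<pi>" and Lp: "(\<lambda>\<omega>. \<pi> (Z \<omega>)) \<in> Lp_functions M p"
  shows "Lp_converges M p (\<lambda>n. (\<lambda>\<omega>. \<pi> (Z' \<omega>)) \<circ> g n) (\<lambda>\<omega>. \<pi> (Z \<omega>))"
proof -
  interpret prob_space M by fact
  have [measurable]: "\<pi> \<in> borel_measurable borel" by (rule borel_measurable_continuous_onI[OF \<pi>])
  have [measurable]: "g n \<in> M \<rightarrow>\<^sub>M M" for n using g by (rule mp_maps_measurable)
  have distr_g: "distr M M (g n) = M" for n using g[of n] by (simp add: mp_maps_def)
  have law_g: "distr M borel (\<lambda>\<omega>. Z' (g n \<omega>)) = distr M borel Z" for n
  proof -
    have "distr M borel (\<lambda>\<omega>. Z' (g n \<omega>)) = distr (distr M M (g n)) borel Z'"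
      by (simp add: distr_distr comp_def)
    then show ?thesis by (simp add: distr_g law)
  qed
  define \<phi> where "\<phi> = (\<lambda>z. norm (\<pi> z) powr p)"
  have [measurable]: "\<phi> \<in> borel_measurable borel" unfolding \<phi>_def by measurable
  define I where "I = (\<integral>\<omega>. \<phi> (Z \<omega>) \<partial>M)"
  have int_Z: "integrable M (\<lambda>\<omega>. \<phi> (Z \<omega>))"
    using Lp by (simp add: Lp_functions_def \<phi>_def)
  have int_g: "integrable M (\<lambda>\<omega>. \<phi> (Z' (g n \<omega>)))" and I_g: "(\<integral>\<omega>. \<phi> (Z' (g n \<omega>)) \<partial>M) = I" for n
  proof -
    have "integrable (distr M borel (\<lambda>\<omega>. Z' (g n \<omega>))) \<phi>"
      unfolding law_g using int_Z by (subst integrable_distr_eq) auto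
    then show "integrable M (\<lambda>\<omega>. \<phi> (Z' (g n \<omega>)))" by (subst (asm) integrable_distr_eq) auto
    have "(\<integral>\<omega>. \<phi> (Z' (g n \<omega>)) \<partial>M) = (\<integral>z. \<phi> z \<partial>distr M borel (\<lambda>\<omega>. Z' (g n \<omega>)))"
      by (subst integral_distr) auto
    then show "(\<integral>\<omega>. \<phi> (Z' (g n \<omega>)) \<partial>M) = I"
      unfolding law_g I_def by (subst (asm) integral_distr) auto
  qed
  define D where "D = (\<lambda>z :: 's \<times> 's. norm (\<pi> (snd z) - \<pi> (fst z)) powr p)"
  define H where "H = (\<lambda>z :: 's \<times> 's. 2 powr p * (\<phi> (snd z) + \<phi> (fst z)) - D z)"
  have cont: "continuous_on UNIV H"
  proof -
    have f: "continuous_on UNIV (\<lambda>z :: 's \<times> 's. \<pi> (fst z))" "continuous_on UNIV (\<lambda>z :: 's \<times> 's. \<pi> (snd z))"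
      using \<pi> by (auto intro!: continuous_on_compose2[OF \<pi>] continuous_intros)
    show ?thesis
      unfolding H_def D_def \<phi>_def using \<open>0 < p\<close>
      by (intro continuous_intros continuous_on_powr' f) auto
  qed
  have H_nonneg: "0 \<le> H z" for z
    using norm_diff_powr_le[of p "\<pi> (snd z)" "\<pi> (fst z)"] \<open>0 < p\<close> by (simp add: H_def D_def \<phi>_def)
  define s where "s = (\<lambda>n. \<integral>\<omega>. D (Z \<omega>, Z' (g n \<omega>)) \<partial>M)"
  have int_D: "integrable M (\<lambda>\<omega>. D (Z \<omega>, Z' (g n \<omega>)))" for n
  proof (rule Bochner_Integration.integrable_bound)
    show "integrable M (\<lambda>\<omega>. 2 powr p * (\<phi> (Z' (g n \<omega>)) + \<phi> (Z \<omega>)))"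
      using int_g int_Z by auto
    show "(\<lambda>\<omega>. D (Z \<omega>, Z' (g n \<omega>))) \<in> borel_measurable M" unfolding D_def by measurable
    have "D z \<le> 2 powr p * (\<phi> (snd z) + \<phi> (fst z))" for z using H_nonneg[of z] by (simp add: H_def)
    from this[of "(Z _, Z' (g n _))"]
    show "AE \<omega> in M. norm (D (Z \<omega>, Z' (g n \<omega>))) \<le> norm (2 powr p * (\<phi> (Z' (g n \<omega>)) + \<phi> (Z \<omega>)))"
      by (auto simp: D_def \<phi>_def)
  qed
  have int_H: "integrable M (\<lambda>\<omega>. H (Z \<omega>, Z' (g n \<omega>)))"
    and H_g: "(\<integral>\<omega>. H (Z \<omega>, Z' (g n \<omega>)) \<partial>M) = 2 powr p * (I + I) - s n" for n
    unfolding H_def fst_conv snd_conv s_def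
    using int_D int_g int_Z I_g by (auto simp: I_def)
  have D_diag: "D (z, z) = 0" for z using \<open>0 < p\<close> by (simp add: D_def)
  have int_diag: "integrable M (\<lambda>\<omega>. H (Z \<omega>, Z \<omega>))"
    and H_diag: "(\<integral>\<omega>. H (Z \<omega>, Z \<omega>) \<partial>M) = 2 powr p * (I + I)"
    unfolding H_def fst_conv snd_conv D_diag using int_Z by (auto simp: I_def)
  have [measurable]: "H \<in> borel_measurable borel" by (rule borel_measurable_continuous_onI[OF cont])
  define T where "T = (\<lambda>R :: nat. \<lambda>z. min (H z) (real R))"
  have [measurable]: "T R \<in> borel_measurable borel" for R unfolding T_def by measurable
  have T_abs: "\<bar>T R z\<bar> \<le> R" for R z using H_nonneg[of z] by (simp add: T_def)
  have T_int: "integrable M (\<lambda>\<omega>. T R (f \<omega>))" if [measurable]: "f \<in> borel_measurable M" for R f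
    by (rule integrable_const_bound[of _ "real R"]) (auto simp: T_abs)
  have "(\<lambda>n. \<integral>\<omega>. T R (Z \<omega>, Z' (g n \<omega>)) \<partial>M) \<longlonglongrightarrow> (\<integral>\<omega>. T R (Z \<omega>, Z \<omega>) \<partial>M)" for R
  proof -
    have "continuous_on UNIV (T R)" unfolding T_def by (intro continuous_intros cont)
    moreover have "bounded (range (T R))" using T_abs by (auto simp: bounded_iff)
    ultimately have "(\<lambda>n. \<integral>z. T R z \<partial>distr M borel (\<lambda>\<omega>. (Z \<omega>, Z' (g n \<omega>))))
        \<longlonglongrightarrow> (\<integral>z. T R z \<partial>distr M borel (\<lambda>\<omega>. (Z \<omega>, Z \<omega>)))"
      using conv by (simp add: narrowly_converges_def)
    then show ?thesis by (simp add: integral_distr)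
  qed
  note T_conv = this
  have "(\<lambda>R. \<integral>\<omega>. T R (Z \<omega>, Z \<omega>) \<partial>M) \<longlonglongrightarrow> (\<integral>\<omega>. H (Z \<omega>, Z \<omega>) \<partial>M)"
  proof (rule integral_dominated_convergence[where w="\<lambda>\<omega>. H (Z \<omega>, Z \<omega>)"])
    show "AE \<omega> in M. (\<lambda>R. T R (Z \<omega>, Z \<omega>)) \<longlonglongrightarrow> H (Z \<omega>, Z \<omega>)"
    proof (rule AE_I2)
      fix \<omega>
      obtain m :: nat where m: "H (Z \<omega>, Z \<omega>) \<le> m" using real_arch_simple by blast
      have "T R (Z \<omega>, Z \<omega>) = H (Z \<omega>, Z \<omega>)" if "R \<ge> m" for R
      proof -
        have "real m \<le> real R" using that by simp
        then show ?thesis using m unfolding T_def by linarith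
      qed
      then have "\<forall>\<^sub>F R in sequentially. T R (Z \<omega>, Z \<omega>) = H (Z \<omega>, Z \<omega>)"
        using eventually_sequentially by blast
      then show "(\<lambda>R. T R (Z \<omega>, Z \<omega>)) \<longlonglongrightarrow> H (Z \<omega>, Z \<omega>)" by (rule tendsto_eventually)
    qed
    show "AE \<omega> in M. norm (T R (Z \<omega>, Z \<omega>)) \<le> H (Z \<omega>, Z \<omega>)" for R
      using H_nonneg by (simp add: T_def min_def)
  qed (auto simp: int_diag)
  then have T_sup: "(\<lambda>R. \<integral>\<omega>. T R (Z \<omega>, Z \<omega>) \<partial>M) \<longlonglongrightarrow> 2 powr p * (I + I)"
    unfolding H_diag .
  have s_nonneg: "0 \<le> s n" for n unfolding s_def by (intro Bochner_Integration.integral_nonneg) (simp add: D_def)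
  have s_conv: "s \<longlonglongrightarrow> 0"
  proof (rule LIMSEQ_I)
    fix e :: real assume "0 < e"
    then have "\<forall>\<^sub>F R in sequentially. 2 powr p * (I + I) - e < (\<integral>\<omega>. T R (Z \<omega>, Z \<omega>) \<partial>M)"
      by (intro order_tendstoD(1)[OF T_sup]) simp
    then obtain R where R: "2 powr p * (I + I) - e < (\<integral>\<omega>. T R (Z \<omega>, Z \<omega>) \<partial>M)"
      using eventually_happens'[OF sequentially_bot] by blast
    have "\<forall>\<^sub>F n in sequentially. 2 powr p * (I + I) - e < (\<integral>\<omega>. T R (Z \<omega>, Z' (g n \<omega>)) \<partial>M)"
      by (rule order_tendstoD(1)[OF T_conv R])
    then obtain m where m: "\<forall>n\<ge>m. 2 powr p * (I + I) - e < (\<integral>\<omega>. T R (Z \<omega>, Z' (g n \<omega>)) \<partial>M)"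
      unfolding eventually_sequentially ..
    have "norm (s n - 0) < e" if "n \<ge> m" for n
    proof -
      have "(\<integral>\<omega>. T R (Z \<omega>, Z' (g n \<omega>)) \<partial>M) \<le> (\<integral>\<omega>. H (Z \<omega>, Z' (g n \<omega>)) \<partial>M)"
        by (intro integral_mono int_H T_int) (auto simp: T_def)
      then show ?thesis using m[rule_format, OF that] s_nonneg[of n] unfolding H_g by simp
    qed
    then show "\<exists>no. \<forall>n\<ge>no. norm (s n - 0) < e" by blast
  qed
  have "(\<lambda>n. s n powr (1 / p)) \<longlonglongrightarrow> 0 powr (1 / p)"
    using \<open>0 < p\<close> s_nonneg by (intro tendsto_powr' s_conv tendsto_const) auto
  then have "(\<lambda>n. Lp_norm M p (\<lambda>\<omega>. ((\<lambda>\<omega>. \<pi> (Z' \<omega>)) \<circ> g n) \<omega> - \<pi> (Z \<omega>))) \<longlonglongrightarrow> 0"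
    by (simp add: Lp_norm_def s_def D_def)
  moreover have "(\<lambda>\<omega>. \<pi> (Z' \<omega>)) \<circ> g n \<in> Lp_functions M p" for n
    using int_g[of n] by (simp add: Lp_functions_def comp_def \<phi>_def)
  ultimately show ?thesis using Lp by (simp add: Lp_converges_def)
qed

lemma diagonal_coupling:
  fixes Z Z' :: "'a \<Rightarrow> 's::second_countable_topology"
  assumes "prob_space M" and Z[measurable]: "Z \<in> borel_measurable M"
    and "distr M borel Z = distr M borel Z'"
  shows "distr M borel (\<lambda>\<omega>. (Z \<omega>, Z \<omega>)) \<in> couplings (distr M borel Z) (distr M borel Z')"
proof -
  have meas: "(\<lambda>\<omega>. (Z \<omega>, Z \<omega>)) \<in> borel_measurable M" by measurable
  have "fst \<in> borel_measurable (borel :: ('s \<times> 's) measure)" "snd \<in> borel_measurable (borel :: ('s \<times> 's) measure)"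
    by (auto intro!: borel_measurable_continuous_onI continuous_intros)
  then show ?thesis
    using assms borel_prob_measure_distr[OF assms(1) meas]
    by (simp add: couplings_def distr_distr meas comp_def)
qed

section \<open>The chain of partitions of a segmentation\<close>

text \<open>Enumerate \<open>\<NN>\<close> and use directedness to pass, at each step, to a common multiple of the current
  element, of the next element of the enumeration, and of some strictly larger element.\<close>

lemma cofinal_divisibility_chain:
  assumes "unbounded_directed \<NN>"
  obtains N where "range N \<subseteq> \<NN>" "dvd_strictly_increasing N" "\<And>l. l \<in> \<NN> \<Longrightarrow> \<exists>n. l dvd N n"
proof -
  have pos: "\<And>l. l \<in> \<NN> \<Longrightarrow> 0 < l" and unb: "\<not> bdd_above \<NN>"
    and dir: "\<And>m n. m \<in> \<NN> \<Longrightarrow> n \<in> \<NN> \<Longrightarrow> \<exists>l\<in>\<NN>. m dvd l \<and> n dvd l"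
    using assms by (auto simp: unbounded_directed_def)
  have "\<NN> \<noteq> {}" using unb by auto
  define e where "e = from_nat_into \<NN>"
  have e: "e n \<in> \<NN>" for n using from_nat_into[OF \<open>\<NN> \<noteq> {}\<close>] by (simp add: e_def)
  have "\<exists>N. \<forall>n. N n \<in> \<NN> \<and> (N n dvd N (Suc n) \<and> N n < N (Suc n) \<and> e n dvd N (Suc n))"
  proof (rule dependent_nat_choice)
    show "\<exists>l. l \<in> \<NN>" using e by blast
    fix l n assume l: "l \<in> \<NN>"
    obtain t where t: "t \<in> \<NN>" "l < t" using unb unfolding bdd_above_def by (meson not_le)
    obtain r where r: "r \<in> \<NN>" "l dvd r" "t dvd r" using dir[OF l t(1)] by blast
    obtain r' where r': "r' \<in> \<NN>" "r dvd r'" "e n dvd r'" using dir[OF r(1) e[of n]] by blast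
    have "t \<le> r'" using r(3) r'(2) pos[OF r'(1)] by (meson dvd_imp_le dvd_trans)
    then show "\<exists>r'. r' \<in> \<NN> \<and> l dvd r' \<and> l < r' \<and> e n dvd r'"
      using r r' t by (intro exI[of _ r']) (auto intro: dvd_trans)
  qed
  then obtain N where N: "\<And>n. N n \<in> \<NN>" "\<And>n. N n dvd N (Suc n)" "\<And>n. N n < N (Suc n)" "\<And>n. e n dvd N (Suc n)"
    by blast
  have "N m dvd N n" if "m < n" for m n
    using that by (induction n) (auto simp: less_Suc_eq intro: N(2) dvd_trans[OF _ N(2)])
  moreover have "N m < N n" if "m < n" for m n
    using lift_Suc_mono_less[of N, OF N(3) that] .
  ultimately have "dvd_strictly_increasing N"
    unfolding dvd_strictly_increasing_def monotone_def by (metis less_irrefl_nat)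
  moreover have "\<exists>n. l dvd N n" if l: "l \<in> \<NN>" for l
  proof -
    obtain n where "e n = l" using from_nat_into_surj[OF countableI_type l] by (auto simp: e_def)
    then show ?thesis using N(4)[of n] by blast
  qed
  ultimately show thesis using N(1) that by blast
qed

definition cell_index :: "(nat \<Rightarrow> 'a set) \<Rightarrow> nat \<Rightarrow> 'a \<Rightarrow> nat" where
  "cell_index A n \<omega> = (THE k. k < n \<and> \<omega> \<in> A k)"

lemma cell_index_eq:
  assumes "is_partition M n A" "k < n" "\<omega> \<in> A k"
  shows "cell_index A n \<omega> = k"
  unfolding cell_index_def
proof (rule the_equality)
  fix j assume "j < n \<and> \<omega> \<in> A j"
  then show "j = k" using assms unfolding is_partition_def disjoint_family_on_def by blast
qed (use assms in simp)

lemma cell_index_mem: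
  assumes "is_partition M n A" "\<omega> \<in> space M"
  shows "cell_index A n \<omega> < n" "\<omega> \<in> A (cell_index A n \<omega>)"
proof -
  obtain k where k: "k < n" "\<omega> \<in> A k" using assms unfolding is_partition_def by blast
  then have "cell_index A n \<omega> = k" by (rule cell_index_eq[OF assms(1)])
  then show "cell_index A n \<omega> < n" "\<omega> \<in> A (cell_index A n \<omega>)" using k by simp_all
qed

lemma cell_index_level:
  assumes "is_partition M n A"
  shows "{\<omega> \<in> space M. cell_index A n \<omega> = k} = (if k < n then A k else {})"
proof -
  have "A k \<subseteq> space M" if "k < n" using assms that unfolding is_partition_def by blast
  then show ?thesis using cell_index_mem[OF assms] cell_index_eq[OF assms] by auto
qed

text \<open>Cells of any level \<open>l\<close> are finite unions of cells of a level \<open>N n\<close> that is a multiple of \<open>l\<close>, so a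
  cofinal chain generates the same \<open>\<sigma>\<close>-algebra as the whole segmentation.\<close>

lemma refining_partitions_cell_index:
  assumes refined: "refined_standard_borel_prob_space \<NN> M P"
    and N: "range N \<subseteq> \<NN>" "dvd_strictly_increasing N" and cofinal: "\<And>l. l \<in> \<NN> \<Longrightarrow> \<exists>n. l dvd N n"
  shows "refining_partitions M N (\<lambda>n. cell_index (P (N n)) (N n))"
proof -
  have prob: "prob_space M" and std: "standard_borel M" and ud: "unbounded_directed \<NN>"
    and seg: "segmentation \<NN> M P"
    using refined by (auto simp: refined_standard_borel_prob_space_def refined_standard_borel_space_def)
  have part: "is_partition M l (P l)" if "l \<in> \<NN>" for l using seg that by (simp add: segmentation_def)
  have part_N: "is_partition M (N n) (P (N n))" for n using N(1) by (intro part) auto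
  have nest: "(\<Union>k<K. P (K * l) (m * K + k)) = P l m" if "l \<in> \<NN>" "K * l \<in> \<NN>" "m < l" for l K m
    using seg that by (simp add: segmentation_def)
  have N_in: "N n \<in> \<NN>" for n using N(1) by blast
  have "\<NN> \<subseteq> {0<..}" using ud by (simp add: unbounded_directed_def)
  from subsetD[OF this N_in] have pos: "0 < N n" for n by simp
  have N_mono: "N m dvd N n \<and> N m \<noteq> N n" if "m < n" for m n
    using N(2) that by (simp add: dvd_strictly_increasing_def monotone_def)
  have N_dvd: "N m dvd N n" if "m \<le> n" for m n
    using N_mono[of m n] that by (cases "m = n") auto
  have "strict_mono N"
  proof (rule strict_monoI)
    fix m n :: nat assume "m < n"
    then show "N m < N n" using N_mono[of m n] pos[of n] by (meson dvd_imp_le le_neq_implies_less)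
  qed
  let ?c = "\<lambda>n. cell_index (P (N n)) (N n)"
  have cell_sets: "{\<omega> \<in> space M. ?c n \<omega> = k} \<in> sets M" for n k
    using part_N[of n] by (auto simp: cell_index_level[OF part_N] is_partition_def)
  have gen: "sets M = sigma_sets (space M) {{\<omega> \<in> space M. ?c n \<omega> = k} | n k. True}" (is "_ = ?S")
  proof (rule antisym)
    show "?S \<subseteq> sets M" by (rule sets.sigma_sets_subset) (use cell_sets in auto)
    interpret S: sigma_algebra "space M" ?S by (rule sigma_algebra_sigma_sets) auto
    have cell: "P l m \<in> ?S" if l: "l \<in> \<NN>" "m < l" for l m
    proof -
      obtain n where "l dvd N n" using cofinal[OF l(1)] by blast
      then obtain K where K: "N n = K * l" by (metis dvd_def mult.commute)
      have "P (N n) (m * K + k) \<in> ?S" if "k < K" for k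
      proof -
        have "m * K + k < (m + 1) * K" using that by simp
        also have "\<dots> \<le> l * K" using l(2) by (intro mult_le_mono1) simp
        finally have "m * K + k < N n" by (simp add: K mult.commute)
        then have "P (N n) (m * K + k) = {\<omega> \<in> space M. cell_index (P (N n)) (N n) \<omega> = m * K + k}"
          using cell_index_level[OF part_N, of n "m * K + k"] by simp
        then show ?thesis by (intro sigma_sets.Basic) blast
      qed
      then have "(\<Union>k<K. P (N n) (m * K + k)) \<in> ?S" by (intro S.finite_UN) auto
      moreover have "K * l \<in> \<NN>" using N_in[of n] K by simp
      ultimately show ?thesis using nest[OF l(1) _ l(2)] K by simp
    qed
    have "sets (partition_algebra M P l) \<subseteq> ?S" if l: "l \<in> \<NN>" for l
    proof -
      have "P l ` {..<l} \<subseteq> Pow (space M)" using part[OF l] unfolding is_partition_def by blast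
      then have "sets (partition_algebra M P l) = sigma_sets (space M) (P l ` {..<l})"
        by (simp add: partition_algebra_def)
      also have "\<dots> \<subseteq> ?S" using cell[OF l] by (intro S.sigma_sets_subset) auto
      finally show ?thesis .
    qed
    then have "sigma_sets (space M) (\<Union>l\<in>\<NN>. sets (partition_algebra M P l)) \<subseteq> ?S"
      by (intro S.sigma_sets_subset) blast
    then show "sets M \<subseteq> ?S" using seg by (simp add: segmentation_def)
  qed
  interpret prob_space M by (rule prob)
  show ?thesis
  proof
    show "0 < N n" for n by (rule pos)
    show "N n dvd N m" if "n \<le> m" for n m using that by (rule N_dvd)
    show "n \<le> N n" for n using \<open>strict_mono N\<close> by (rule strict_mono_imp_increasing)
    show "?c n \<omega> < N n" if "\<omega> \<in> space M" for n \<omega> using cell_index_mem(1)[OF part_N that] .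
    show "?c n \<in> M \<rightarrow>\<^sub>M count_space UNIV" for n
      using cell_sets[of n] by (subst measurable_count_space_eq2_countable)
        (auto simp: vimage_def Int_def conj_commute)
    show "prob {\<omega> \<in> space M. ?c n \<omega> = k} = 1 / N n" if "k < N n" for n k
      using seg N_in[of n] that by (simp add: cell_index_level[OF part_N] segmentation_def prob_space)
    show "?c n \<omega> = ?c m \<omega> div (N m div N n)" if "n \<le> m" and \<omega>: "\<omega> \<in> space M" for n m \<omega>
    proof -
      define K where "K = N m div N n"
      have K: "N m = K * N n" using N_dvd[OF that(1)] by (simp add: K_def)
      define j where "j = ?c m \<omega> div K"
      have "j < N n"
        using cell_index_mem(1)[OF part_N \<omega>, of m] unfolding K j_def by (simp add: less_mult_imp_div_less mult.commute)
      have "K > 0" using pos[of m] K by (cases K) auto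
      have "\<omega> \<in> P (N m) (j * K + ?c m \<omega> mod K)"
        using cell_index_mem(2)[OF part_N \<omega>, of m] by (simp add: j_def)
      moreover have "?c m \<omega> mod K < K" using \<open>K > 0\<close> by simp
      ultimately have "\<omega> \<in> (\<Union>k<K. P (K * N n) (j * K + k))" unfolding K by blast
      also have "\<dots> = P (N n) j"
        by (rule nest[OF N_in _ \<open>j < N n\<close>]) (use N_in[of m] K in simp)
      finally show ?thesis
        using cell_index_eq[OF part_N \<open>j < N n\<close>] by (simp add: j_def K_def)
    qed
    show "sets M = ?S" by (rule gen)
    show "standard_borel M" by (rule std)
  qed
qed

lemma partition_algebra_measurable:
  assumes part: "is_partition M n (P n)" and g: "g \<in> space M \<rightarrow> space M"
    and \<sigma>: "\<And>\<omega>. \<omega> \<in> space M \<Longrightarrow> cell_index (P n) n (g \<omega>) = \<sigma> (cell_index (P n) n \<omega>)"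
  shows "g \<in> partition_algebra M P n \<rightarrow>\<^sub>M partition_algebra M P n"
proof -
  have sub: "P n ` {..<n} \<subseteq> Pow (space M)" using part unfolding is_partition_def by blast
  then have sp: "space (partition_algebra M P n) = space M"
    and se: "sets (partition_algebra M P n) = sigma_sets (space M) (P n ` {..<n})"
    by (simp_all add: partition_algebra_def space_measure_of_conv)
  show ?thesis
  proof (rule measurable_sigma_sets[OF se sub])
    show "g \<in> space (partition_algebra M P n) \<rightarrow> space M" using g by (simp add: sp)
    fix A assume "A \<in> P n ` {..<n}"
    then obtain k where k: "k < n" "A = P n k" by blast
    have lev: "P n j = {\<omega> \<in> space M. cell_index (P n) n \<omega> = j}" if "j < n" for j
      using that cell_index_level[OF part, of j] by simp
    have "g -` A \<inter> space M = {\<omega> \<in> space M. \<sigma> (cell_index (P n) n \<omega>) = k}"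
      using g \<sigma> unfolding k(2) lev[OF k(1)] by (auto simp: Pi_iff)
    also have "\<dots> = (\<Union>j\<in>{j. j < n \<and> \<sigma> j = k}. {\<omega> \<in> space M. cell_index (P n) n \<omega> = j})"
      using cell_index_mem(1)[OF part] by auto
    also have "\<dots> = (\<Union>j\<in>{j. j < n \<and> \<sigma> j = k}. P n j)"
      using lev by simp
    also have "\<dots> \<in> sets (partition_algebra M P n)"
      unfolding se by (rule sigma_sets_UNION) (auto intro: sigma_sets.Basic)
    finally show "g -` A \<inter> space (partition_algebra M P n) \<in> sets (partition_algebra M P n)"
      by (simp add: sp)
  qed
qed

lemma couplings_approximable:
  fixes Z :: "'a \<Rightarrow> 'z::second_countable_topology" and Z' :: "'a \<Rightarrow> 'w::second_countable_topology"
  assumes refined: "refined_standard_borel_prob_space \<NN> M P"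
    and Z: "Z \<in> borel_measurable M" and Z': "Z' \<in> borel_measurable M"
    and \<mu>: "\<mu> \<in> couplings (distr M borel Z) (distr M borel Z')"
  obtains N g where "range N \<subseteq> \<NN>" "dvd_strictly_increasing N"
    "\<And>n. g n \<in> mp_maps_sub M (partition_algebra M P (N n))"
    "narrowly_converges (\<lambda>n. distr M borel (\<lambda>\<omega>. (Z \<omega>, Z' (g n \<omega>)))) \<mu>"
proof -
  have "unbounded_directed \<NN>" and seg: "segmentation \<NN> M P"
    using refined by (auto simp: refined_standard_borel_prob_space_def refined_standard_borel_space_def)
  then obtain N where N: "range N \<subseteq> \<NN>" "dvd_strictly_increasing N" "\<And>l. l \<in> \<NN> \<Longrightarrow> \<exists>n. l dvd N n"
    using cofinal_divisibility_chain[of \<NN>] by blast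
  interpret refining_partitions M N "\<lambda>n. cell_index (P (N n)) (N n)"
    using refined N by (rule refining_partitions_cell_index)
  obtain k g where k: "strict_mono (k :: nat \<Rightarrow> nat)" and g: "\<And>n. g n \<in> mp_maps M"
    "\<And>n. \<exists>\<sigma>. \<forall>\<omega>\<in>space M. cell_index (P (N (k n))) (N (k n)) (g n \<omega>) = \<sigma> (cell_index (P (N (k n))) (N (k n)) \<omega>)"
    "narrowly_converges (\<lambda>n. distr M borel (\<lambda>\<omega>. (Z \<omega>, Z' (g n \<omega>)))) \<mu>"
    by (rule coupling_approximation[OF Z Z' \<mu>]) (rule that)
  show thesis
  proof (rule that[of "N \<circ> k" g])
    show "range (N \<circ> k) \<subseteq> \<NN>" using N(1) by auto
    show "dvd_strictly_increasing (N \<circ> k)"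
      using N(2) k by (simp add: dvd_strictly_increasing_def monotone_def strict_mono_def)
    fix n
    obtain \<sigma> where "\<forall>\<omega>\<in>space M. cell_index (P (N (k n))) (N (k n)) (g n \<omega>) = \<sigma> (cell_index (P (N (k n))) (N (k n)) \<omega>)"
      using g(2) by blast
    moreover have "is_partition M (N (k n)) (P (N (k n)))" using seg subsetD[OF N(1) rangeI] by (simp add: segmentation_def)
    moreover have "g n \<in> space M \<rightarrow> space M"
      using measurable_space[OF mp_maps_measurable[OF g(1)]] by blast
    ultimately show "g n \<in> mp_maps_sub M (partition_algebra M P ((N \<circ> k) n))"
      using g(1) by (simp add: mp_maps_sub_def partition_algebra_measurable)
  qed (rule g(3))
qed

theorem corollary3p21:
  fixes \<NN> :: "nat set"
    and M :: "'a measure"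
    and P :: "nat \<Rightarrow> nat \<Rightarrow> 'a set"
  assumes "refined_standard_borel_prob_space \<NN> M P"
  shows
    "(\<forall>(Z :: 'a \<Rightarrow> 'z::{banach, second_countable_topology})
       (Z' :: 'a \<Rightarrow> 'w::{banach, second_countable_topology}).
        Z \<in> borel_measurable M \<longrightarrow> Z' \<in> borel_measurable M \<longrightarrow>
        (\<forall>\<mu> \<in> couplings (distr M borel Z) (distr M borel Z').
          \<exists>N g. range N \<subseteq> \<NN> \<and> dvd_strictly_increasing N \<and>
            (\<forall>n. g n \<in> mp_maps_sub M (partition_algebra M P (N n))) \<and>
            narrowly_converges (\<lambda>n. distr M borel (\<lambda>\<omega>. (Z \<omega>, Z' (g n \<omega>)))) \<mu>))
     \<and>
     (\<forall>(p::real) (q::real)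
       (X :: 'a \<Rightarrow> 'x::{banach, second_countable_topology}) (X' :: 'a \<Rightarrow> 'x)
       (Y :: 'a \<Rightarrow> 'y::{banach, second_countable_topology}) (Y' :: 'a \<Rightarrow> 'y).
        1 \<le> p \<longrightarrow> 1 \<le> q \<longrightarrow>
        X \<in> Lp_functions M p \<longrightarrow> X' \<in> Lp_functions M p \<longrightarrow>
        Y \<in> Lp_functions M q \<longrightarrow> Y' \<in> Lp_functions M q \<longrightarrow>
        distr M borel (\<lambda>\<omega>. (X \<omega>, Y \<omega>)) = distr M borel (\<lambda>\<omega>. (X' \<omega>, Y' \<omega>)) \<longrightarrow>
        (\<exists>N g. range N \<subseteq> \<NN> \<and> dvd_strictly_increasing N \<and>
          (\<forall>n. g n \<in> mp_maps_sub M (partition_algebra M P (N n))) \<and>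
          Lp_converges M p (\<lambda>n. X' \<circ> g n) X \<and>
          Lp_converges M q (\<lambda>n. Y' \<circ> g n) Y))"
proof (intro conjI allI impI ballI)
  fix Z :: "'a \<Rightarrow> 'z" and Z' :: "'a \<Rightarrow> 'w" and \<mu>
  assume "Z \<in> borel_measurable M" "Z' \<in> borel_measurable M"
    "\<mu> \<in> couplings (distr M borel Z) (distr M borel Z')"
  then obtain N g where "range N \<subseteq> \<NN>" "dvd_strictly_increasing N"
    "\<And>n. g n \<in> mp_maps_sub M (partition_algebra M P (N n))"
    "narrowly_converges (\<lambda>n. distr M borel (\<lambda>\<omega>. (Z \<omega>, Z' (g n \<omega>)))) \<mu>"
    by (rule couplings_approximable[OF assms]) (rule that)
  then show "\<exists>N g. range N \<subseteq> \<NN> \<and> dvd_strictly_increasing N \<and>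
            (\<forall>n. g n \<in> mp_maps_sub M (partition_algebra M P (N n))) \<and>
            narrowly_converges (\<lambda>n. distr M borel (\<lambda>\<omega>. (Z \<omega>, Z' (g n \<omega>)))) \<mu>"
    by (intro exI[of _ N] exI[of _ g] conjI allI)
next
  fix p q :: real and X X' :: "'a \<Rightarrow> 'x" and Y Y' :: "'a \<Rightarrow> 'y"
  assume pq: "1 \<le> p" "1 \<le> q"
    and X: "X \<in> Lp_functions M p" and X': "X' \<in> Lp_functions M p"
    and Y: "Y \<in> Lp_functions M q" and Y': "Y' \<in> Lp_functions M q"
    and law: "distr M borel (\<lambda>\<omega>. (X \<omega>, Y \<omega>)) = distr M borel (\<lambda>\<omega>. (X' \<omega>, Y' \<omega>))"
  have prob: "prob_space M" using assms by (simp add: refined_standard_borel_prob_space_def)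
  define Z where "Z = (\<lambda>\<omega>. (X \<omega>, Y \<omega>))"
  define Z' where "Z' = (\<lambda>\<omega>. (X' \<omega>, Y' \<omega>))"
  have Z: "Z \<in> borel_measurable M" "Z' \<in> borel_measurable M"
    using X X' Y Y' by (auto simp: Z_def Z'_def Lp_functions_def intro!: borel_measurable_Pair)
  have law_Z: "distr M borel Z = distr M borel Z'" using law by (simp add: Z_def Z'_def)
  obtain N g where N: "range N \<subseteq> \<NN>" "dvd_strictly_increasing N"
    and g: "\<And>n. g n \<in> mp_maps_sub M (partition_algebra M P (N n))"
    and conv: "narrowly_converges (\<lambda>n. distr M borel (\<lambda>\<omega>. (Z \<omega>, Z' (g n \<omega>)))) (distr M borel (\<lambda>\<omega>. (Z \<omega>, Z \<omega>)))"
    using couplings_approximable[OF assms Z diagonal_coupling[OF prob Z(1) law_Z]] by blast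
  have g_mp: "g n \<in> mp_maps M" for n using g[of n] by (simp add: mp_maps_sub_def)
  have "Lp_converges M p (\<lambda>n. (\<lambda>\<omega>. fst (Z' \<omega>)) \<circ> g n) (\<lambda>\<omega>. fst (Z \<omega>))"
    by (rule Lp_converges_of_narrow[OF prob Z law_Z g_mp conv])
      (use pq X in \<open>auto simp: Z_def intro: continuous_intros\<close>)
  moreover have "Lp_converges M q (\<lambda>n. (\<lambda>\<omega>. snd (Z' \<omega>)) \<circ> g n) (\<lambda>\<omega>. snd (Z \<omega>))"
    by (rule Lp_converges_of_narrow[OF prob Z law_Z g_mp conv])
      (use pq Y in \<open>auto simp: Z_def intro: continuous_intros\<close>)
  ultimately have "Lp_converges M p (\<lambda>n. X' \<circ> g n) X \<and> Lp_converges M q (\<lambda>n. Y' \<circ> g n) Y"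
    by (simp add: Z_def Z'_def)
  then show "\<exists>N g. range N \<subseteq> \<NN> \<and> dvd_strictly_increasing N \<and>
          (\<forall>n. g n \<in> mp_maps_sub M (partition_algebra M P (N n))) \<and>
          Lp_converges M p (\<lambda>n. X' \<circ> g n) X \<and> Lp_converges M q (\<lambda>n. Y' \<circ> g n) Y"
    using N g by (intro exI[of _ N] exI[of _ g] conjI allI) auto
qed

end
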